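(* Let $2\le j\le n$ be integers, let $f\in\mathbb Z[x_1,\dots,x_n]$ be any polynomial, and let $U\subset\mathbb R^{j-1}$ be any open connected set defined by $\mathrm{Hp}(f,[x_n,\dots,x_j])\neq 0$. Put $$S=U\setminus \mathrm{Zero}\big(\{\mathrm{Hp}(f,[x_n,\dots,x_j],x_t)\mid t=j,\dots,n\}\big).$$ Then $f$ is open delineable on the open connected set $S$ with respect to $\overline{\mathrm{Hp}}(f,j)$ and $\widetilde{\mathrm{Hp}}(f,j)$. As a result, every reduced open CAD of $f$ with respect to $[x_n,\dots,x_j]$ is an open sample defined by $f$ in $\mathbb R^n$.
   Context: Notation: $\mathbf x_k=(x_1,\dots,x_k)$. For a set of polynomials, $\mathrm{Zero}$ denotes its set of common real zeros. "An open connected set defined by $f\ne0$" (or "of $f\neq 0$") in $\mathbb R^k$, for $f\in\mathbb Z[\mathbf x_k]$, means a maximal one, i.e. a connected component of $\{f\neq0\}\subset\mathbb R^k$. Squarefree part: $\mathrm{sqrf}(h)$ is the product of the pairwise distinct irreducible primitive factors of positive degree of $h$ in $\mathbb Z[\mathbf x_n]$ (normalized to have positive leading coefficient); $\mathrm{sqrf}(h)=1$ if $h$ is constant. Brown projection: for a polynomial $h$ and a variable $y$, if $\deg(h,y)>0$ then $\mathrm{Bp}(h,[y])=\mathrm{Res}\big(\mathrm{sqrf}(h),\partial\,\mathrm{sqrf}(h)/\partial y,\,y\big)$ (Sylvester resultant with respect to $y$); otherwise $\mathrm{Bp}(h,[y])=h$. Operator $\mathrm{Hp}$: for a list $[\mathbf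 y]=[y_1,\dots,y_m]$ of distinct variables from $\{x_1,\dots,x_n\}$, define recursively $\mathrm{Hp}(f,[\,])=f$, $$\mathrm{Hp}(f,[\mathbf y],y_i)=\mathrm{Bp}\big(\mathrm{Hp}(f,[y_1,\dots,y_{i-1},y_{i+1},\dots,y_m]),[y_i]\big)\quad(1\le i\le m),$$ $$\mathrm{Hp}(f,[\mathbf y])=\gcd\big(\mathrm{Hp}(f,[\mathbf y],y_1),\dots,\mathrm{Hp}(f,[\mathbf y],y_m)\big).$$ Set (as ordered lists, whose entries are polynomials in $\mathbf x_n,\mathbf x_{n-1},\dots,\mathbf x_{j-1}$ respectively) $\overline{\mathrm{Hp}}(f,j)=[f,\mathrm{Hp}(f,[x_n]),\dots,\mathrm{Hp}(f,[x_n,\dots,x_j])]$ and $\widetilde{\mathrm{Hp}}(f,j)=[f,\mathrm{Hp}(f,[x_n],x_n),\mathrm{Hp}(f,[x_n,x_{n-1}],x_{n-1}),\dots,\mathrm{Hp}(f,[x_n,\dots,x_j],x_j)]$. Open sample: a set $T\subseteq\mathbb R^k$ is an open sample defined by $h\in\mathbb{Z}[\mathbf x_k]$ if $T$ meets every open connected set defined by $h\ne0$ in $\mathbb R^k$. $T_{h,g\neq0}$ denotes an open sample defined by $h$ such that moreover $g(\alpha)\ne0$ for all $\alpha\in T_{h,g\ne0}$. The same notions are used for univariate real polynomials obtained by substitution. OpenSP: given lists $L_1=[f_n(\mathbf x_n),\dots,f_l(\mathbf x_l)]$, $L_2=[g_n(\mathbf x_n),\dots,g_l(\mathbf x_l)]$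 and a set $T\subset\mathbb R^l$, an output of $\mathtt{OpenSP}(L_1,L_2,T)$ is any set obtained as follows: $O_l=T$; for $i=l+1,\dots,n$, choose for each $\alpha\in O_{i-1}$ a univariate open sample $T_\alpha=T_{f_i(\alpha,x_i),\,g_i(\alpha,x_i)\neq0}\subset\mathbb R$ and put $O_i=\bigcup_{\alpha\in O_{i-1}}\{\alpha\}\times T_\alpha$; the output is $O_n$. Open delineable: let $L_1=[f_n(\mathbf x_n),\dots,f_l(\mathbf x_l)]$, $L_2=[g_n(\mathbf x_n),\dots,g_l(\mathbf x_l)]$, $S$ an open set of $\mathbb R^s$ with $s\le l$, and $S'=S\times\mathbb R^{l-s}$. $f_n$ is open delineable on $S$ w.r.t. $L_1$ and $L_2$ if for every maximal open connected set $V\subset\mathbb R^n$ defined by $f_n\ne0$ with $V\cap(S'\times\mathbb R^{n-l})\neq\emptyset$, every $\alpha\in S'$ with $f_l(\alpha)g_l(\alpha)\neq0$, and every output $\mathcal A$ of $\mathtt{OpenSP}(L_1,L_2,\{\alpha\})$, one has $\mathcal A\cap V\ne\emptyset$. Reduced open CAD: a reduced open CAD of $f$ w.r.t. $[x_n,\dots,x_j]$ is any output of $\mathtt{OpenSP}(\overline{\mathrm{Hp}}(f,j),\widetilde{\mathrm{Hp}}(f,j),T)$, where $T\subset\mathbb R^{j-1}$ is any open sample defined by $\mathrm{Hp}(f,[x_n,\dots,x_j])$ on which $\mathrm{Hp}(f,[x_n,\dots,x_j],x_j)$ vanishes nowhere. *)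

theory Defs
  imports
    "HOL-Analysis.Abstract_Euclidean_Space"
    "HOL-Library.Poly_Mapping"
    "Subresultants.Resultant_Prelim"
begin

section \<open>Integer polynomials in the variables x_1, x_2, ...\<close>

text \<open>A polynomial maps exponent vectors to coefficients. To match the coordinates of
  \<^const>\<open>Euclidean_space\<close>, which are numbered from 0, the variable x_i has index i - 1.\<close>

type_synonym zpoly = "(nat \<Rightarrow>\<^sub>0 nat) \<Rightarrow>\<^sub>0 int"

definition Zx :: "nat \<Rightarrow> zpoly set" where
  "Zx n = {p. \<forall>m \<in> Poly_Mapping.keys p. Poly_Mapping.keys m \<subseteq> {..<n}}"

definition meval :: "(nat \<Rightarrow> real) \<Rightarrow> zpoly \<Rightarrow> real" where
  "meval x p = (\<Sum>m\<in>Poly_Mapping.keys p. of_int (Poly_Mapping.lookup p m) *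
     (\<Prod>i\<in>Poly_Mapping.keys m. x i ^ Poly_Mapping.lookup m i))"

text \<open>p as a univariate polynomial in the variable with index y; its coefficients
  do not contain y.\<close>

definition to_upoly :: "nat \<Rightarrow> zpoly \<Rightarrow> zpoly poly" where
  "to_upoly y p = (\<Sum>m\<in>Poly_Mapping.keys p.
     Polynomial.monom (Poly_Mapping.single (Poly_Mapping.update y 0 m) (Poly_Mapping.lookup p m))
       (Poly_Mapping.lookup m y))"

definition const_poly :: "zpoly \<Rightarrow> bool" where
  "const_poly p \<longleftrightarrow> Poly_Mapping.keys p \<subseteq> {0}"

definition primitive_poly :: "zpoly \<Rightarrow> bool" where
  "primitive_poly p \<longleftrightarrow> (\<forall>c::int. of_int c dvd p \<longrightarrow> is_unit c)"

text \<open>The order on exponent vectors is the lexicographic one of the library. It only serves to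
  pick one of the two signs of a factor or of a gcd.\<close>

definition lcoeff :: "zpoly \<Rightarrow> int" where
  "lcoeff p = (if p = 0 then 0 else Poly_Mapping.lookup p (Max (Poly_Mapping.keys p)))"

definition sqrf :: "zpoly \<Rightarrow> zpoly" where
  "sqrf h = (if const_poly h then 1
     else \<Prod>{p. Factorial_Ring.irreducible p \<and> primitive_poly p \<and> \<not> const_poly p \<and>
              lcoeff p > 0 \<and> p dvd h})"

definition mgcd :: "zpoly set \<Rightarrow> zpoly" where
  "mgcd A = (THE d. (\<forall>p\<in>A. d dvd p) \<and> (\<forall>e. (\<forall>p\<in>A. e dvd p) \<longrightarrow> e dvd d) \<and>
                    (d = 0 \<or> lcoeff d > 0))"


section \<open>Projection operators\<close>

definition Bp :: "zpoly \<Rightarrow> nat \<Rightarrow> zpoly" where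
  "Bp h y = (if Polynomial.degree (to_upoly y h) > 0
     then resultant (to_upoly y (sqrf h)) (pderiv (to_upoly y (sqrf h)))
     else h)"

function Hp :: "zpoly \<Rightarrow> nat list \<Rightarrow> zpoly" where
  "Hp f [] = f"
| "Hp f (y # ys) = mgcd ((\<lambda>z. Bp (Hp f (remove1 z (y # ys))) z) ` set (y # ys))"
  by pat_completeness auto
termination
  by (relation "measure (\<lambda>(f, ys). length ys)") (auto simp: length_remove1 dest: length_pos_if_in_set)

definition Hp_at :: "zpoly \<Rightarrow> nat list \<Rightarrow> nat \<Rightarrow> zpoly" where
  "Hp_at f ys y = Bp (Hp f (remove1 y ys)) y"

text \<open>The list [x_n, ..., x_i] of variables.\<close>

definition xvars :: "nat \<Rightarrow> nat \<Rightarrow> nat list" where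
  "xvars n i = rev [i - 1..<n]"

definition Hp_bar :: "nat \<Rightarrow> zpoly \<Rightarrow> nat \<Rightarrow> zpoly list" where
  "Hp_bar n f j = f # map (\<lambda>i. Hp f (xvars n i)) (rev [j..<Suc n])"

definition Hp_tilde :: "nat \<Rightarrow> zpoly \<Rightarrow> nat \<Rightarrow> zpoly list" where
  "Hp_tilde n f j = f # map (\<lambda>i. Hp_at f (xvars n i) (i - 1)) (rev [j..<Suc n])"


section \<open>Open samples and open CADs\<close>

definition Zero :: "nat \<Rightarrow> zpoly set \<Rightarrow> (nat \<Rightarrow> real) set" where
  "Zero k P = {x \<in> topspace (Euclidean_space k). \<forall>p\<in>P. meval x p = 0}"

text \<open>The maximal open connected sets defined by h \<noteq> 0 in the space X.\<close>

definition open_conn_sets :: "'a topology \<Rightarrow> ('a \<Rightarrow> real) \<Rightarrow> 'a set set" where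
  "open_conn_sets X h = connected_components_of (subtopology X {x. h x \<noteq> 0})"

definition open_sample :: "'a topology \<Rightarrow> ('a \<Rightarrow> real) \<Rightarrow> 'a set \<Rightarrow> bool" where
  "open_sample X h T \<longleftrightarrow> T \<subseteq> topspace X \<and> (\<forall>C \<in> open_conn_sets X h. T \<inter> C \<noteq> {})"

definition open_sample_nz :: "'a topology \<Rightarrow> ('a \<Rightarrow> real) \<Rightarrow> ('a \<Rightarrow> real) \<Rightarrow> 'a set \<Rightarrow> bool" where
  "open_sample_nz X h g T \<longleftrightarrow> open_sample X h T \<and> (\<forall>\<alpha>\<in>T. g \<alpha> \<noteq> 0)"

text \<open>The set of all outputs of OpenSP, where \<open>L1 = [f_n, ..., f_l]\<close> and \<open>L2 = [g_n, ..., g_l]\<close>,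
  so that \<open>f_i = L1 ! (n - i)\<close>. Points of R^(i-1) are padded with zeros, and \<open>\<alpha>(i - 1 := t)\<close> is
  the point (\<alpha>, t) of R^i.\<close>

definition OpenSP ::
  "nat \<Rightarrow> nat \<Rightarrow> zpoly list \<Rightarrow> zpoly list \<Rightarrow> (nat \<Rightarrow> real) set \<Rightarrow> (nat \<Rightarrow> real) set set" where
  "OpenSP n l L1 L2 T = {A. \<exists>Q. Q l = T \<and> Q n = A \<and>
     (\<forall>i\<in>{l<..n}. \<exists>\<tau>.
        (\<forall>\<alpha> \<in> Q (i - 1). open_sample_nz euclideanreal
           (\<lambda>t. meval (\<alpha>(i - 1 := t)) (L1 ! (n - i)))
           (\<lambda>t. meval (\<alpha>(i - 1 := t)) (L2 ! (n - i))) (\<tau> \<alpha>)) \<and>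
        Q i = (\<Union>\<alpha> \<in> Q (i - 1). (\<lambda>t. \<alpha>(i - 1 := t)) ` \<tau> \<alpha>))}"

text \<open>\<open>cylinder s k S\<close> is S \<times> R^(k-s), for a subset S of R^s and s \<le> k.\<close>

definition cylinder :: "nat \<Rightarrow> nat \<Rightarrow> (nat \<Rightarrow> real) set \<Rightarrow> (nat \<Rightarrow> real) set" where
  "cylinder s k S = {x \<in> topspace (Euclidean_space k). (\<lambda>i. if i < s then x i else 0) \<in> S}"

text \<open>Meant for an open subset S of R^s with s \<le> l \<le> n. The heads of the lists are f_n and g_n,
  their last entries f_l and g_l.\<close>

definition open_delineable ::
  "nat \<Rightarrow> nat \<Rightarrow> nat \<Rightarrow> zpoly list \<Rightarrow> zpoly list \<Rightarrow> (nat \<Rightarrow> real) set \<Rightarrow> bool" where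
  "open_delineable n l s L1 L2 S \<longleftrightarrow>
     (\<forall>V \<in> open_conn_sets (Euclidean_space n) (\<lambda>x. meval x (hd L1)).
        V \<inter> cylinder l n (cylinder s l S) \<noteq> {} \<longrightarrow>
        (\<forall>\<alpha> \<in> cylinder s l S. meval \<alpha> (last L1) * meval \<alpha> (last L2) \<noteq> 0 \<longrightarrow>
           (\<forall>A \<in> OpenSP n l L1 L2 {\<alpha>}. A \<inter> V \<noteq> {})))"

definition reduced_open_CAD :: "nat \<Rightarrow> zpoly \<Rightarrow> nat \<Rightarrow> (nat \<Rightarrow> real) set \<Rightarrow> bool" where
  "reduced_open_CAD n f j A \<longleftrightarrow>
     (\<exists>T. open_sample_nz (Euclidean_space (j - 1)) (\<lambda>x. meval x (Hp f (xvars n j)))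
            (\<lambda>x. meval x (Hp_at f (xvars n j) (j - 1))) T \<and>
          A \<in> OpenSP n (j - 1) (Hp_bar n f j) (Hp_tilde n f j) T)"

end

theory Submission
  imports Defs "Subresultants.Subresultant_Gcd" "HOL-Computational_Algebra.Field_as_Ring"
begin

text \<open>All polynomials are viewed as functions on the space of all real sequences, in which the
  spaces R^k and their components become cylinders. Let V be a component of f \<noteq> 0. The key claim is
  that, for every component U of Hp(f, [Y]) \<noteq> 0 over which V has a point, V has points over a dense
  subset of U. It is proved by induction on the number of eliminated variables. The polynomials
  Hp(f, [Y], z) are products of Hp(f, [Y]) with cofactors of gcd 1; the common zeros of the cofactors
  have codimension at least two, so removing them leaves U connected. It therefore suffices to argue
  near a point where some Bp(h, [z]) = Hp(f, [Y], z) is not zero, with h = Hp(f, [Y'])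
  and Y' = Y without z. There the leading coefficient and the discriminant of sqrf h do not vanish,
  so every point with h \<noteq> 0 can be moved inside h \<noteq> 0 to any neighboring fiber, and the induction
  hypothesis applies to the component of h \<noteq> 0 that is reached.

  For OpenSP, density moves V into a small neighborhood of the current sample point \<beta>; by local
  delineability V then has a point over the component of h \<noteq> 0 of some (\<beta>, t'), and the sample on the
  fiber contains a t in the same interval as t'. The gcds exist because integer polynomials
  factor uniquely, which is shown by induction on the number of variables.\<close>


text \<open>The claim covers arbitrary distinct lists Y, although OpenSP only uses [x_n, ..., x_i]:
  which Hp(f, [Y], z) is nonzero differs from point to point, hence so does the variable that is put
  back first, and the induction has to pass through all orders of elimination. This freedom is also
  what makes the gcd useful. With a fixed z the whole hypersurface where Hp(f, [Y], z) vanishes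
  would have to be removed, which can cut U into pieces and separate V from the point of interest;
  with a varying z only the common zeros of the cofactors are lost. Roots are neither ordered nor
  shown to depend continuously on the base point. All that is needed is a path from a point off the
  zero set to each neighboring fiber, made of a vertical segment and a horizontal move at a height
  where no root occurs.\<close>

lemma mpoly_eq_sum: "(p::zpoly) = (\<Sum>m\<in>Poly_Mapping.keys p. Poly_Mapping.single m (Poly_Mapping.lookup p m))"
  by (rule poly_mapping_eqI) (simp add: lookup_sum lookup_single when_def in_keys_iff)

text \<open>Since \<open>meval\<close> and \<open>to_upoly\<close> are additive, this reduces their
  multiplicativity to monomials.\<close>

lemma mpoly_induct [case_names single add]:
  fixes p :: zpoly
  assumes s: "\<And>m c. P (Poly_Mapping.single m c)" and a: "\<And>p q. P p \<Longrightarrow> P q \<Longrightarrow> P (p + q)"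
  shows "P p"
proof (induction p rule: update_induct)
  case const
  show ?case using s[of 0 0] by simp
next
  case (update f k c)
  have "Poly_Mapping.update k c f = f + Poly_Mapping.single k c"
    using update.hyps by (intro poly_mapping_eqI) (auto simp: lookup_update lookup_add lookup_single when_def in_keys_iff)
  then show ?case using a s update.IH by metis
qed

subsection \<open>Evaluation\<close>

definition mon :: "(nat \<Rightarrow> real) \<Rightarrow> (nat \<Rightarrow>\<^sub>0 nat) \<Rightarrow> real" where
  "mon x m = (\<Prod>i\<in>Poly_Mapping.keys m. x i ^ Poly_Mapping.lookup m i)"

lemma mon_superset:
  assumes "finite K" "Poly_Mapping.keys m \<subseteq> K"
  shows "mon x m = (\<Prod>i\<in>K. x i ^ Poly_Mapping.lookup m i)"
  unfolding mon_def by (rule prod.mono_neutral_left) (use assms in \<open>auto simp: in_keys_iff\<close>)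

lemma mon_0 [simp]: "mon x 0 = 1"
  by (simp add: mon_def)

lemma mon_add: "mon x (m + m') = mon x m * mon x m'"
proof -
  let ?K = "Poly_Mapping.keys m \<union> Poly_Mapping.keys m'"
  have "Poly_Mapping.keys (m + m') \<subseteq> ?K" by (rule Poly_Mapping.keys_add)
  then show ?thesis
    by (simp add: mon_superset[of ?K] lookup_add power_add prod.distrib)
qed

text \<open>Keys can cancel in a sum of polynomials; over a fixed finite superset of the keys,
  additivity becomes a termwise identity.\<close>

lemma meval_superset:
  assumes "finite K" "Poly_Mapping.keys p \<subseteq> K"
  shows "meval x p = (\<Sum>m\<in>K. of_int (Poly_Mapping.lookup p m) * mon x m)"
  unfolding meval_def mon_def[symmetric]
  by (rule sum.mono_neutral_left) (use assms in \<open>auto simp: in_keys_iff\<close>)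

lemma meval_add [simp]: "meval x (p + q) = meval x p + meval x q"
proof -
  let ?K = "Poly_Mapping.keys p \<union> Poly_Mapping.keys q"
  have "Poly_Mapping.keys (p + q) \<subseteq> ?K" by (rule Poly_Mapping.keys_add)
  then show ?thesis
    by (simp add: meval_superset[of ?K] lookup_add algebra_simps sum.distrib)
qed

lemma meval_single [simp]: "meval x (Poly_Mapping.single m c) = of_int c * mon x m"
  by (simp add: meval_superset[of "{m}"])

lemma meval_0 [simp]: "meval x 0 = 0"
  by (simp add: meval_def)

lemma meval_1 [simp]: "meval x 1 = 1"
  using meval_single[of x 0 1] by simp

lemma meval_uminus [simp]: "meval x (- p) = - meval x p"
  using meval_add[of x p "- p"] by simp

lemma meval_mult [simp]: "meval x (p * q) = meval x p * meval x q"
proof (induction p rule: mpoly_induct)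
  case (single m c)
  show ?case
    by (induction q rule: mpoly_induct) (simp_all add: mult_single mon_add algebra_simps)
next
  case (add p q)
  then show ?case by (simp add: algebra_simps)
qed

interpretation meval: comm_ring_hom "meval x" for x
  by unfold_locales auto

subsection \<open>Variables\<close>

definition vars :: "zpoly \<Rightarrow> nat set" where
  "vars p = (\<Union>m\<in>Poly_Mapping.keys p. Poly_Mapping.keys m)"

lemma finite_vars [simp]: "finite (vars p)"
  by (simp add: vars_def)

lemma Zx_iff: "p \<in> Zx n \<longleftrightarrow> vars p \<subseteq> {..<n}"
  by (auto simp: Zx_def vars_def)

lemma vars_add: "vars (p + q) \<subseteq> vars p \<union> vars q"
  using Poly_Mapping.keys_add[of p q] by (auto simp: vars_def)

lemma vars_single_subset: "vars (Poly_Mapping.single m c) \<subseteq> Poly_Mapping.keys m"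
  by (auto simp: vars_def split: if_splits)

lemma vars_mult_subset: "vars (p * q) \<subseteq> vars p \<union> vars q"
proof
  fix i assume "i \<in> vars (p * q)"
  then obtain m where m: "m \<in> Poly_Mapping.keys (p * q)" "i \<in> Poly_Mapping.keys m" by (auto simp: vars_def)
  then obtain a b where "m = a + b" "a \<in> Poly_Mapping.keys p" "b \<in> Poly_Mapping.keys q"
    using Poly_Mapping.keys_mult[of p q] by blast
  with m Poly_Mapping.keys_add[of a b] show "i \<in> vars p \<union> vars q" by (auto simp: vars_def)
qed

lemma vars_uminus [simp]: "vars (- p) = vars p"
  by (simp add: vars_def)

lemma vars_0 [simp]: "vars 0 = {}" and vars_1 [simp]: "vars 1 = {}"
  by (auto simp: vars_def)

lemma single_0_of_int: "Poly_Mapping.single 0 c = (of_int c :: zpoly)"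
  by (metis single_of_int of_int_eq_id id_apply)

lemma vars_of_int [simp]: "vars (of_int c) = {}"
  using vars_single_subset[of 0 c] by (simp add: single_0_of_int)

lemma vars_power_subset: "vars (p ^ k) \<subseteq> vars p"
  by (induction k) (use vars_mult_subset in force)+

lemma vars_sum_subset: "(\<And>a. a \<in> A \<Longrightarrow> vars (g a) \<subseteq> V) \<Longrightarrow> vars (sum g A) \<subseteq> V"
  by (induction A rule: infinite_finite_induct) (use vars_add in \<open>auto, blast\<close>)

lemma vars_prod_subset: "(\<And>a. a \<in> A \<Longrightarrow> vars (g a) \<subseteq> V) \<Longrightarrow> vars (prod g A) \<subseteq> V"
  by (induction A rule: infinite_finite_induct) (use vars_mult_subset in \<open>auto, blast\<close>)

lemma vars_leI:
  "vars p \<subseteq> W \<Longrightarrow> vars q \<subseteq> W \<Longrightarrow> vars (p + q) \<subseteq> W"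
  "vars p \<subseteq> W \<Longrightarrow> vars q \<subseteq> W \<Longrightarrow> vars (p - q) \<subseteq> W"
  "vars p \<subseteq> W \<Longrightarrow> vars q \<subseteq> W \<Longrightarrow> vars (p * q) \<subseteq> W"
  "vars p \<subseteq> W \<Longrightarrow> vars (p ^ k) \<subseteq> W"
  using vars_add[of p q] vars_add[of p "- q"] vars_mult_subset[of p q] vars_power_subset[of p k] by auto

lemma meval_cong:
  assumes "\<And>i. i \<in> vars p \<Longrightarrow> x i = x' i"
  shows "meval x p = meval x' p"
  unfolding meval_def
  by (intro sum.cong refl arg_cong2[where f = "(*)"] prod.cong) (use assms in \<open>force simp: vars_def\<close>)

lemma vars_empty_iff: "vars p = {} \<longleftrightarrow> (\<exists>c. p = of_int c)"
proof
  assume v: "vars p = {}"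
  then have "Poly_Mapping.keys p \<subseteq> {0}"
    by (auto simp: vars_def)
  then have "p = Poly_Mapping.single 0 (Poly_Mapping.lookup p 0)"
    by (intro poly_mapping_eqI) (auto simp: lookup_single when_def in_keys_iff)
  then show "\<exists>c. p = of_int c"
    by (metis single_0_of_int)
qed auto

lemma const_poly_iff: "const_poly p \<longleftrightarrow> vars p = {}"
  unfolding const_poly_def vars_def by auto

lemma meval_of_int [simp]: "meval x (of_int c) = of_int c"
  by (rule meval.hom_of_int)

subsection \<open>Polynomials as univariate polynomials\<close>

definition X :: "nat \<Rightarrow> zpoly" where
  "X y = Poly_Mapping.single (Poly_Mapping.single y 1) 1"

lemma X_power: "X y ^ k = Poly_Mapping.single (Poly_Mapping.single y k) 1"
proof (induction k)
  case (Suc k)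
  then show ?case by (simp add: mult_single X_def flip: single_add)
qed simp

lemma vars_X [simp]: "vars (X y) = {y}"
  by (auto simp: vars_def X_def)

lemma meval_X [simp]: "meval x (X y) = x y"
  by (simp add: mon_def X_def)

lemma to_upoly_superset:
  assumes "finite K" "Poly_Mapping.keys p \<subseteq> K"
  shows "to_upoly y p = (\<Sum>m\<in>K. Polynomial.monom
    (Poly_Mapping.single (Poly_Mapping.update y 0 m) (Poly_Mapping.lookup p m)) (Poly_Mapping.lookup m y))"
  unfolding to_upoly_def
  by (rule sum.mono_neutral_left) (use assms in \<open>auto simp: in_keys_iff\<close>)

lemma to_upoly_single: "to_upoly y (Poly_Mapping.single m c) =
    Polynomial.monom (Poly_Mapping.single (Poly_Mapping.update y 0 m) c) (Poly_Mapping.lookup m y)"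
  by (simp add: to_upoly_superset[of "{m}"])

lemma to_upoly_0 [simp]: "to_upoly y 0 = 0"
  by (simp add: to_upoly_def)

lemma to_upoly_add: "to_upoly y (p + q) = to_upoly y p + to_upoly y q"
proof -
  let ?K = "Poly_Mapping.keys p \<union> Poly_Mapping.keys q"
  have "Poly_Mapping.keys (p + q) \<subseteq> ?K" by (rule Poly_Mapping.keys_add)
  then show ?thesis
    by (simp add: to_upoly_superset[of ?K] lookup_add single_add sum.distrib flip: add_monom)
qed

lemma update_0_add: "Poly_Mapping.update y 0 (m + m' :: nat \<Rightarrow>\<^sub>0 nat) = Poly_Mapping.update y 0 m + Poly_Mapping.update y 0 m'"
  by (rule poly_mapping_eqI) (simp add: lookup_update lookup_add)

lemma to_upoly_mult: "to_upoly y (p * q) = to_upoly y p * to_upoly y q"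
proof (induction p rule: mpoly_induct)
  case (single m c)
  show ?case
    by (induction q rule: mpoly_induct)
      (simp_all add: mult_single to_upoly_single to_upoly_add mult_monom update_0_add lookup_add algebra_simps)
next
  case (add p q)
  then show ?case by (simp add: algebra_simps to_upoly_add)
qed

lemma update_0_eq: "Poly_Mapping.lookup m y = 0 \<Longrightarrow> Poly_Mapping.update y 0 m = (m :: nat \<Rightarrow>\<^sub>0 nat)"
  by (rule poly_mapping_eqI) (auto simp: lookup_update)

lemma update_0_decomp: "Poly_Mapping.update y 0 m + Poly_Mapping.single y (Poly_Mapping.lookup m y) = (m :: nat \<Rightarrow>\<^sub>0 nat)"
  by (rule poly_mapping_eqI) (auto simp: lookup_update lookup_add lookup_single when_def)

lemma to_upoly_free: "y \<notin> vars p \<Longrightarrow> to_upoly y p = [:p:]"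
proof -
  assume y: "y \<notin> vars p"
  have "to_upoly y p = (\<Sum>m\<in>Poly_Mapping.keys p. [:Poly_Mapping.single m (Poly_Mapping.lookup p m):])"
    unfolding to_upoly_def
  proof (intro sum.cong refl)
    fix m assume "m \<in> Poly_Mapping.keys p"
    then have "Poly_Mapping.lookup m y = 0" using y by (auto simp: vars_def in_keys_iff)
    then show "Polynomial.monom (Poly_Mapping.single (Poly_Mapping.update y 0 m) (Poly_Mapping.lookup p m)) (Poly_Mapping.lookup m y)
      = [:Poly_Mapping.single m (Poly_Mapping.lookup p m):]" by (simp add: update_0_eq monom_0)
  qed
  also have "\<dots> = [:p:]"
  proof -
    have "(\<Sum>m\<in>K. [:g m:]) = [:sum g K:]" for K and g :: "(nat \<Rightarrow>\<^sub>0 nat) \<Rightarrow> zpoly"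
      by (induction K rule: infinite_finite_induct) auto
    then show ?thesis by (simp flip: mpoly_eq_sum)
  qed
  finally show ?thesis .
qed

lemma to_upoly_X [simp]: "to_upoly y (X y) = [:0, 1:]"
proof -
  have "Poly_Mapping.update y 0 (Poly_Mapping.single y 1) = (0 :: nat \<Rightarrow>\<^sub>0 nat)"
    by (rule poly_mapping_eqI) (auto simp: lookup_update lookup_single when_def)
  then show ?thesis by (simp add: X_def to_upoly_single monom_altdef)
qed

lemma poly_to_upoly [simp]: "poly (to_upoly y p) (X y) = p"
proof (induction p rule: mpoly_induct)
  case (single m c)
  show ?case
    by (simp only: to_upoly_single poly_monom X_power mult_single update_0_decomp mult_1_right)
qed (simp add: to_upoly_add)


lemma vars_coeff: "vars (Polynomial.coeff (to_upoly y p) i) \<subseteq> vars p - {y}"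
  unfolding to_upoly_def coeff_sum
  by (intro vars_sum_subset)
    (auto simp: vars_def keys_update in_keys_iff lookup_update split: if_splits)

lemma to_upoly_poly_X:
  assumes "\<And>i. y \<notin> vars (Polynomial.coeff P i)"
  shows "to_upoly y (poly P (X y)) = P"
  using assms
proof (induction P)
  case (pCons a P)
  have "y \<notin> vars a" using pCons.prems[of 0] by simp
  moreover have "y \<notin> vars (Polynomial.coeff P i)" for i using pCons.prems[of "Suc i"] by simp
  ultimately show ?case
    using pCons.IH by (simp add: to_upoly_add to_upoly_mult to_upoly_free)
qed simp

lemma to_upoly_eq_0_iff [simp]: "to_upoly y p = 0 \<longleftrightarrow> p = 0"
  by (metis poly_to_upoly poly_0 to_upoly_0)

lemma to_upoly_uminus: "to_upoly y (- p) = - to_upoly y p"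
  using to_upoly_add[of y p "- p"] by (simp add: eq_neg_iff_add_eq_0 add.commute)

lemma to_upoly_diff: "to_upoly y (p - q) = to_upoly y p - to_upoly y q"
  using to_upoly_add[of y p "- q"] by (simp add: to_upoly_uminus)

lemma to_upoly_1 [simp]: "to_upoly y 1 = 1"
  by (simp add: to_upoly_free pCons_one)

definition dg :: "nat \<Rightarrow> zpoly \<Rightarrow> nat" where
  "dg y p = Polynomial.degree (to_upoly y p)"

lemma dg_mult: "p \<noteq> 0 \<Longrightarrow> q \<noteq> 0 \<Longrightarrow> dg y (p * q) = dg y p + dg y q"
  by (simp add: dg_def to_upoly_mult degree_mult_eq)

lemma dg_eq_0_iff: "dg y p = 0 \<longleftrightarrow> y \<notin> vars p"
proof
  assume "dg y p = 0"
  then obtain c where c: "to_upoly y p = [:c:]" by (auto simp: dg_def elim: degree_eq_zeroE)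
  with poly_to_upoly[of y p] have "p = c" by simp
  then show "y \<notin> vars p" using vars_coeff[of y p 0] c by auto
qed (simp add: dg_def to_upoly_free)

lemma dg_pos_iff: "dg y p > 0 \<longleftrightarrow> y \<in> vars p"
  using dg_eq_0_iff[of y p] by auto

text \<open>No variable can cancel in a product of nonzero polynomials, because the degree in each
  variable is additive.\<close>

lemma vars_mult: "p \<noteq> 0 \<Longrightarrow> q \<noteq> 0 \<Longrightarrow> vars (p * q) = vars p \<union> vars q"
  by (auto simp: dg_mult simp flip: dg_pos_iff)

lemma vars_dvd: "d dvd p \<Longrightarrow> p \<noteq> 0 \<Longrightarrow> vars d \<subseteq> vars p"
  by (auto simp: vars_mult elim!: dvdE)

lemma meval_upd_sum: "meval (x(y := t)) p = (\<Sum>i\<le>dg y p. meval x (Polynomial.coeff (to_upoly y p) i) * t ^ i)"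
proof -
  have "meval (x(y := t)) p = meval (x(y := t)) (poly (to_upoly y p) (X y))" by simp
  also have "\<dots> = (\<Sum>i\<le>dg y p. meval (x(y := t)) (Polynomial.coeff (to_upoly y p) i) * t ^ i)"
    unfolding poly_altdef dg_def by (simp add: meval.hom_sum meval.hom_power del: poly_to_upoly)
  also have "\<dots> = (\<Sum>i\<le>dg y p. meval x (Polynomial.coeff (to_upoly y p) i) * t ^ i)"
    using vars_coeff[of y p] by (intro sum.cong refl arg_cong2[where f = "(*)"] meval_cong) auto
  finally show ?thesis .
qed

text \<open>The restriction of \<open>p\<close> to a line in direction \<open>y\<close> is a real
  polynomial in one variable, to which finiteness of roots, the mean value theorem and gcds
  apply.\<close>

lemma meval_upd: "meval (x(y := t)) p = poly (map_poly (meval x) (to_upoly y p)) t"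
proof -
  have "meval (x(y := t)) p =
      (\<Sum>i\<le>dg y p. poly (Polynomial.monom (meval x (Polynomial.coeff (to_upoly y p) i)) i) t)"
    by (simp add: poly_monom meval_upd_sum)
  also have "\<dots> = poly (map_poly (meval x) (to_upoly y p)) t"
    unfolding poly_sum[symmetric]
    by (rule arg_cong[where f = "\<lambda>P. poly P t"], rule poly_eqI) (auto simp: coeff_sum coeff_map_poly coeff_eq_0 dg_def)
  finally show ?thesis .
qed

subsection \<open>Unique factorization\<close>

text \<open>The multiplier \<open>c\<close>, free of \<open>y\<close>, avoids fractions: each step
  multiplies \<open>f\<close> by the leading coefficient of \<open>g\<close> in \<open>y\<close> and
  then cancels the top term by a multiple of \<open>g\<close>.\<close>

lemma pseudo_division:
  assumes g: "g \<noteq> 0" "vars g \<subseteq> insert y V" and f: "vars f \<subseteq> insert y V" and y: "y \<notin> V"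
  shows "\<exists>c q r. c \<noteq> 0 \<and> vars c \<subseteq> V \<and> vars q \<subseteq> insert y V \<and> c * f = q * g + r \<and> (r = 0 \<or> dg y r < dg y g)"
  using f
proof (induction "dg y f" arbitrary: f rule: less_induct)
  case less
  show ?case
  proof (cases "f = 0 \<or> dg y f < dg y g")
    case True
    then show ?thesis by (intro exI[of _ 1] exI[of _ 0] exI[of _ f]) auto
  next
    case False
    define n where "n = dg y f - dg y g"
    define a where "a = lead_coeff (to_upoly y g)"
    define b where "b = lead_coeff (to_upoly y f)"
    have ab: "vars a \<subseteq> V" "vars b \<subseteq> V" "a \<noteq> 0"
      using vars_coeff[of y g "dg y g"] vars_coeff[of y f "dg y f"] g less.prems by (auto simp: a_def b_def dg_def)
    then have yab: "y \<notin> vars a" "y \<notin> vars b" using y by auto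
    define h where "h = a * f - b * X y ^ n * g"
    have F: "to_upoly y h = [:a:] * to_upoly y f - Polynomial.monom b n * to_upoly y g"
    proof -
      have "to_upoly y (X y ^ n) = Polynomial.monom 1 n"
        by (induction n) (simp_all add: to_upoly_mult monom_altdef)
      then have "to_upoly y (b * X y ^ n) = Polynomial.monom b n"
        using yab by (simp add: to_upoly_mult to_upoly_free smult_monom)
      then show ?thesis using yab unfolding h_def
        by (simp add: to_upoly_diff to_upoly_mult[of y _ f] to_upoly_mult[of y _ g] to_upoly_free)
    qed
    \<comment> \<open>Both parts of \<open>h\<close> have the coefficient \<open>a * b\<close> in
      degree \<open>dg y f\<close>. If that degree is 0 it cannot drop further, and \<open>h\<close>
      is 0.\<close>
    have "h = 0 \<or> dg y h < dg y f"
    proof -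
      have n: "n + dg y g = dg y f" using False by (simp add: n_def)
      have "Polynomial.degree (Polynomial.monom b n * to_upoly y g) \<le> dg y f"
        using degree_mult_le[of "Polynomial.monom b n" "to_upoly y g"] degree_monom_le[of b n] n by (auto simp: dg_def)
      then have "Polynomial.degree (to_upoly y h) \<le> dg y f"
        unfolding F by (intro degree_diff_le) (auto simp: dg_def)
      moreover have "Polynomial.coeff (to_upoly y h) (dg y f) = 0"
      proof -
        have "dg y f - n = dg y g" "n \<le> dg y f" using n by auto
        then show ?thesis unfolding F coeff_diff coeff_monom_mult
          by (simp add: a_def b_def dg_def mult.commute[of "lead_coeff (to_upoly y g)"])
      qed
      ultimately show ?thesis
        using eq_zero_or_degree_less[of "to_upoly y h" "dg y f"] by (auto simp: dg_def)
    qed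
    have vh: "vars h \<subseteq> insert y V"
      unfolding h_def by (intro vars_leI) (use ab g less.prems in auto)
    obtain c q r where cqr: "c \<noteq> 0" "vars c \<subseteq> V" "vars q \<subseteq> insert y V" "c * h = q * g + r" "r = 0 \<or> dg y r < dg y g"
    proof (cases "h = 0")
      case True
      then show ?thesis using that[of 1 0 0] by simp
    next
      case h: False
      then show ?thesis using less.hyps[OF _ vh] \<open>h = 0 \<or> dg y h < dg y f\<close> that by blast
    qed
    show ?thesis
    proof (intro exI conjI)
      show "c * a \<noteq> 0" using cqr ab by simp
      show "vars (c * a) \<subseteq> V" by (intro vars_leI) (use cqr ab in auto)
      show "vars (q + c * (b * X y ^ n)) \<subseteq> insert y V" by (intro vars_leI) (use cqr ab in auto)
      show "c * a * f = (q + c * (b * X y ^ n)) * g + r"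
        using cqr(4) unfolding h_def by (simp add: algebra_simps)
      show "r = 0 \<or> dg y r < dg y g" by fact
    qed
  qed
qed

text \<open>The pseudo-remainder of an element of \<open>J\<close> by an element \<open>d\<close> of
  least degree is again in \<open>J\<close>, hence 0. In other words, \<open>J\<close> becomes
  principal once nonzero polynomials in the variables \<open>V\<close> are inverted.\<close>

lemma min_degree_element:
  assumes J: "\<And>a. a \<in> J \<Longrightarrow> vars a \<subseteq> insert y V" and y: "y \<notin> V" and a0: "a0 \<in> J" "a0 \<noteq> 0"
    and add: "\<And>a b. a \<in> J \<Longrightarrow> b \<in> J \<Longrightarrow> a + b \<in> J"
    and mult: "\<And>a r. a \<in> J \<Longrightarrow> vars r \<subseteq> insert y V \<Longrightarrow> r * a \<in> J"
  obtains d where "d \<in> J" "d \<noteq> 0"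
    "\<And>a. a \<in> J \<Longrightarrow> \<exists>c q. c \<noteq> 0 \<and> vars c \<subseteq> V \<and> vars q \<subseteq> insert y V \<and> c * a = q * d"
proof -
  obtain d where d: "d \<in> J" "d \<noteq> 0" and min: "\<And>a. a \<in> J \<Longrightarrow> a \<noteq> 0 \<Longrightarrow> dg y d \<le> dg y a"
    using ex_has_least_nat[of "\<lambda>a. a \<in> J \<and> a \<noteq> 0" a0 "dg y"] a0 by auto
  have "\<exists>c q. c \<noteq> 0 \<and> vars c \<subseteq> V \<and> vars q \<subseteq> insert y V \<and> c * a = q * d" if a: "a \<in> J" for a
  proof -
    obtain c q r where *: "c \<noteq> 0" "vars c \<subseteq> V" "vars q \<subseteq> insert y V" "c * a = q * d + r" "r = 0 \<or> dg y r < dg y d"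
      using pseudo_division[OF d(2) J[OF d(1)] J[OF a] y] by blast
    have "r = c * a + (- q) * d" using * by (simp add: algebra_simps)
    moreover have "c * a \<in> J" using mult[OF a] * by blast
    moreover have "(- q) * d \<in> J" using mult[OF d(1), of "- q"] * by simp
    ultimately have "r \<in> J" using add by metis
    then have "r = 0" using min[of r] * by force
    then show ?thesis using * by auto
  qed
  then show ?thesis using that d by blast
qed

section \<open>Units and descent along proper divisors\<close>

lemma unit_iff: "(p :: zpoly) dvd 1 \<longleftrightarrow> p = 1 \<or> p = - 1"
proof
  assume "p dvd 1"
  then obtain q where q: "1 = p * q" by (auto elim: dvdE)
  have "vars p = {}" "vars q = {}" using vars_dvd[of _ 1] q by (metis dvd_triv_left dvd_triv_right vars_1 subset_empty zero_neq_one)+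
  then obtain a b where ab: "p = of_int a" "q = of_int b" by (auto simp: vars_empty_iff)
  then have "a * b = 1" using q by (metis of_int_mult of_int_eq_1_iff)
  then have "a = 1 \<or> a = - 1" using zmult_eq_1_iff by auto
  then show "p = 1 \<or> p = - 1" using ab by auto
qed auto

text \<open>The degrees in the single variables are added up, rather than taking the total degree,
  because additivity under products then follows directly from \<open>dg_mult\<close>.\<close>

definition tdeg :: "zpoly \<Rightarrow> nat" where
  "tdeg p = (\<Sum>y\<in>vars p. dg y p)"

lemma tdeg_superset: "finite K \<Longrightarrow> vars p \<subseteq> K \<Longrightarrow> tdeg p = (\<Sum>y\<in>K. dg y p)"
  unfolding tdeg_def by (rule sum.mono_neutral_left) (auto simp: dg_eq_0_iff)

lemma tdeg_mult: "p \<noteq> 0 \<Longrightarrow> q \<noteq> 0 \<Longrightarrow> tdeg (p * q) = tdeg p + tdeg q"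
  by (simp add: tdeg_superset[of "vars p \<union> vars q"] vars_mult dg_mult sum.distrib)

lemma tdeg_eq_0_iff: "tdeg p = 0 \<longleftrightarrow> vars p = {}"
  by (auto simp: tdeg_def dg_eq_0_iff)

text \<open>This serves to detect integer factors, which no degree sees.\<close>

definition norm1 :: "zpoly \<Rightarrow> nat" where
  "norm1 p = (\<Sum>m\<in>Poly_Mapping.keys p. nat \<bar>Poly_Mapping.lookup p m\<bar>)"

lemma norm1_pos: "p \<noteq> 0 \<Longrightarrow> norm1 p > 0"
  unfolding norm1_def by (intro sum_pos) (auto simp: in_keys_iff)

lemma norm1_of_int_mult: "c \<noteq> 0 \<Longrightarrow> norm1 (of_int c * p) = nat \<bar>c\<bar> * norm1 p"
proof -
  assume c: "c \<noteq> 0"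
  have l: "Poly_Mapping.lookup (of_int c * p) m = c * Poly_Mapping.lookup p m" for m
    unfolding single_0_of_int[symmetric] mult_map_scale_conv_mult[symmetric] by (simp add: Poly_Mapping.map.rep_eq when_def)
  then have "Poly_Mapping.keys (of_int c * p) = Poly_Mapping.keys p" using c by (auto simp: in_keys_iff)
  then show ?thesis unfolding norm1_def by (simp add: l abs_mult nat_mult_distrib sum_distrib_left)
qed

text \<open>A cofactor that is not a unit either contains a variable, and splitting it off lowers
  \<open>tdeg\<close>, or is an integer of absolute value at least 2, and then \<open>tdeg\<close>
  stays and \<open>norm1\<close> drops.\<close>

lemma proper_dvd_measure:
  assumes "p = q * r" "p \<noteq> 0" "\<not> r dvd 1"
  shows "(q, p) \<in> inv_image (less_than <*lex*> less_than) (\<lambda>p. (tdeg p, norm1 p))"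
proof (cases "vars r = {}")
  case False
  then have "tdeg r > 0" using tdeg_eq_0_iff[of r] by simp
  then show ?thesis using assms by (auto simp: tdeg_mult)
next
  case True
  then obtain c where c: "r = of_int c" by (auto simp: vars_empty_iff)
  have "c \<noteq> 0" using assms c by auto
  moreover have "c \<noteq> 1" "c \<noteq> -1" using assms c by (auto simp: unit_iff)
  ultimately have "nat \<bar>c\<bar> \<ge> 2" by auto
  moreover have "norm1 p = nat \<bar>c\<bar> * norm1 q"
    using norm1_of_int_mult[OF \<open>c \<noteq> 0\<close>, of q] assms c by (simp add: mult.commute)
  moreover have "norm1 q > 0" using assms by (intro norm1_pos) auto
  ultimately have "norm1 q < norm1 p" by simp
  moreover have "tdeg p = tdeg q" using assms tdeg_eq_0_iff[of r] True by (auto simp: tdeg_mult)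
  ultimately show ?thesis by auto
qed

text \<open>This stands in for an induction on the number of irreducible factors, which is not yet
  known to be well defined.\<close>

lemma proper_dvd_induct [consumes 1, case_names step]:
  assumes p: "p \<noteq> (0 :: zpoly)"
    and step: "\<And>p. p \<noteq> 0 \<Longrightarrow> (\<And>q r. p = q * r \<Longrightarrow> \<not> r dvd 1 \<Longrightarrow> P q) \<Longrightarrow> P p"
  shows "P p"
proof -
  have "wf (inv_image (less_than <*lex*> less_than) (\<lambda>p. (tdeg p, norm1 p)))" by auto
  then show ?thesis using p
  proof (induction p rule: wf_induct_rule)
    case (less p)
    have "P q" if qr: "p = q * r" "\<not> r dvd 1" for q r
      using less.IH[of q] proper_dvd_measure[OF qr(1) less.prems qr(2)] qr less.prems by auto
    then show ?case using step less.prems by blast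
  qed
qed

lemma irreducible_divisor:
  assumes "p \<noteq> (0 :: zpoly)" "\<not> p dvd 1"
  obtains \<pi> where "Factorial_Ring.irreducible \<pi>" "\<pi> dvd p"
proof -
  have "\<not> p dvd 1 \<longrightarrow> (\<exists>\<pi>. Factorial_Ring.irreducible \<pi> \<and> \<pi> dvd p)"
    using assms(1)
  proof (induction p rule: proper_dvd_induct)
    case (step p)
    show ?case
    proof (cases "Factorial_Ring.irreducible p")
      case False
      show ?thesis
      proof
        assume "\<not> p dvd 1"
        then obtain q r where qr: "p = q * r" "\<not> q dvd 1" "\<not> r dvd 1"
          using False step.hyps by (auto simp: Factorial_Ring.irreducible_def)
        then obtain \<pi> where "Factorial_Ring.irreducible \<pi>" "\<pi> dvd q" using step.IH by blast
        then show "\<exists>\<pi>. Factorial_Ring.irreducible \<pi> \<and> \<pi> dvd p" using qr by auto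
      qed
    qed auto
  qed
  then show ?thesis using assms that by blast
qed

section \<open>Irreducible polynomials are prime\<close>

text \<open>Testing primality only against polynomials in the variables \<open>V\<close> allows an
  induction that adjoins one variable at a time.\<close>

definition prime_on :: "nat set \<Rightarrow> zpoly \<Rightarrow> bool" where
  "prime_on V p \<longleftrightarrow> (\<forall>a b. vars a \<subseteq> V \<longrightarrow> vars b \<subseteq> V \<longrightarrow> p dvd a * b \<longrightarrow> p dvd a \<or> p dvd b)"

text \<open>Being free of \<open>y\<close>, the polynomial \<open>p\<close> is a constant of the
  univariate ring, so multiplication by it acts coefficientwise.\<close>

lemma dvd_coeff_iff:
  assumes y: "y \<notin> vars p"
  shows "p dvd a \<longleftrightarrow> (\<forall>i. p dvd Polynomial.coeff (to_upoly y a) i)"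
proof
  assume "p dvd a"
  then obtain k where "a = p * k" by (auto elim: dvdE)
  then have "to_upoly y a = Polynomial.smult p (to_upoly y k)" using y by (simp add: to_upoly_mult to_upoly_free)
  then show "\<forall>i. p dvd Polynomial.coeff (to_upoly y a) i" by simp
next
  assume "\<forall>i. p dvd Polynomial.coeff (to_upoly y a) i"
  then have "p dvd poly (to_upoly y a) (X y)" unfolding poly_altdef by (intro dvd_sum dvd_mult2) auto
  then show "p dvd a" by (simp)
qed

text \<open>Gauss: if p divides neither a nor b, consider their first coefficients not divisible by p.\<close>

lemma prime_on_insert:
  assumes p: "prime_on V p" "vars p \<subseteq> V" and y: "y \<notin> V"
  shows "prime_on (insert y V) p"
  unfolding prime_on_def
proof (intro allI impI)
  fix a b assume ab: "vars a \<subseteq> insert y V" "vars b \<subseteq> insert y V" "p dvd a * b"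
  have yp: "y \<notin> vars p" using p y by auto
  let ?a = "Polynomial.coeff (to_upoly y a)" and ?b = "Polynomial.coeff (to_upoly y b)"
  show "p dvd a \<or> p dvd b"
  proof (rule ccontr)
    assume "\<not> (p dvd a \<or> p dvd b)"
    then obtain i0 j0 where "\<not> p dvd ?a i0" "\<not> p dvd ?b j0" using dvd_coeff_iff[OF yp] by blast
    then obtain i j where i: "\<not> p dvd ?a i" "\<And>k. k < i \<Longrightarrow> p dvd ?a k"
      and j: "\<not> p dvd ?b j" "\<And>k. k < j \<Longrightarrow> p dvd ?b k"
      using exists_least_iff[of "\<lambda>i. \<not> p dvd ?a i"] exists_least_iff[of "\<lambda>i. \<not> p dvd ?b i"] by blast
    have "p dvd Polynomial.coeff (to_upoly y (a * b)) (i + j)"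
      using ab(3) dvd_coeff_iff[OF yp] by blast
    also have "Polynomial.coeff (to_upoly y (a * b)) (i + j) = (\<Sum>k\<le>i + j. ?a k * ?b (i + j - k))"
      by (simp add: to_upoly_mult coeff_mult)
    also have "\<dots> = ?a i * ?b j + (\<Sum>k\<in>{..i + j} - {i}. ?a k * ?b (i + j - k))"
      by (subst sum.remove[of _ i]) auto
    finally have *: "p dvd ?a i * ?b j + (\<Sum>k\<in>{..i + j} - {i}. ?a k * ?b (i + j - k))" .
    have "p dvd (\<Sum>k\<in>{..i + j} - {i}. ?a k * ?b (i + j - k))"
    proof (intro dvd_sum)
      fix k assume "k \<in> {..i + j} - {i}"
      then consider "k < i" | "i + j - k < j" by (cases "k < i") auto
      then show "p dvd ?a k * ?b (i + j - k)" using i j by cases auto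
    qed
    with * have "p dvd ?a i * ?b j" by (simp add: dvd_add_left_iff)
    moreover have "vars (?a i) \<subseteq> V" "vars (?b j) \<subseteq> V" using vars_coeff[of y a i] vars_coeff[of y b j] ab by auto
    ultimately show False using p i j by (auto simp: prime_on_def)
  qed
qed


text \<open>The irreducible factors of \<open>c\<close> are removed one at a time; by
  \<open>W\<close> each divides \<open>q\<close> or \<open>d\<close>. Those taken out of
  \<open>d\<close> are collected in \<open>e\<close>, so that \<open>e\<close> stays in the
  variables \<open>V\<close>, while what remains of \<open>d\<close> is a true divisor of
  \<open>p\<close>.\<close>

lemma prime_on_cancel:
  assumes W: "\<And>\<pi>. Factorial_Ring.irreducible \<pi> \<Longrightarrow> vars \<pi> \<subseteq> V \<Longrightarrow> prime_on W \<pi>"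
    and c: "c \<noteq> 0" "vars c \<subseteq> V" and eq: "c * p = q * d" and p: "p \<noteq> 0" and sub: "vars q \<subseteq> W" "vars d \<subseteq> W"
  shows "\<exists>q1 d1 e. p = q1 * d1 \<and> d = e * d1 \<and> vars e \<subseteq> V"
  using c eq sub
proof (induction c arbitrary: q d rule: proper_dvd_induct)
  case (step c)
  note IH = step.IH and prems = step.prems
  show ?case
  proof (cases "c dvd 1")
    case True
    then obtain k where k: "1 = c * k" by (auto elim: dvdE)
    have "p = k * (c * p)" using k by (simp add: mult.assoc[symmetric] mult.commute)
    then have "p = (k * q) * d" using prems by (simp add: algebra_simps)
    then show ?thesis by (metis mult_1 vars_1 empty_subsetI)
  next
    case False
    obtain \<pi> where \<pi>: "Factorial_Ring.irreducible \<pi>" and "\<pi> dvd c"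
      using irreducible_divisor[OF step.hyps False] by blast
    then obtain c2 where c2: "c = \<pi> * c2" by (auto elim: dvdE)
    have v: "vars \<pi> \<subseteq> V" "vars c2 \<subseteq> V" using prems(1) step.hyps vars_mult[of \<pi> c2] c2 by auto
    have \<pi>0: "\<pi> \<noteq> 0" and \<pi>1: "\<not> \<pi> dvd 1" using \<pi> by (auto simp: Factorial_Ring.irreducible_def)
    have "\<pi> dvd q * d" using prems(2) c2 by (metis dvd_triv_left mult.assoc)
    then consider "\<pi> dvd q" | "\<pi> dvd d" using W[OF \<pi> v(1)] prems by (auto simp: prime_on_def)
    then show ?thesis
    proof cases
      case 1
      then obtain q2 where q2: "q = \<pi> * q2" by (auto elim: dvdE)
      have "q2 \<noteq> 0" using q2 prems(2) step.hyps p by auto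
      then have "vars q2 \<subseteq> W" using prems(3) q2 \<pi>0 vars_mult[of \<pi> q2] by auto
      moreover have "c2 * p = q2 * d" using prems(2) c2 q2 \<pi>0 by (simp add: mult.assoc)
      ultimately show ?thesis using IH[of c2 \<pi> q2 d] c2 \<pi>1 v prems(4) by (simp add: mult.commute)
    next
      case 2
      then obtain d2 where d2: "d = \<pi> * d2" by (auto elim: dvdE)
      have "d2 \<noteq> 0" using d2 prems(2) step.hyps p by auto
      then have "vars d2 \<subseteq> W" using prems(4) d2 \<pi>0 vars_mult[of \<pi> d2] by auto
      moreover have "c2 * p = q * d2" using prems(2) c2 d2 \<pi>0 by (simp add: mult.assoc mult.left_commute)
      ultimately obtain q1 d1 e where "p = q1 * d1" "d2 = e * d1" "vars e \<subseteq> V"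
        using IH[of c2 \<pi> q d2] c2 \<pi>1 v prems(3) by (auto simp: mult.commute)
      then show ?thesis using d2 v vars_mult_subset[of \<pi> e] by (intro exI[of _ q1] exI[of _ d1] exI[of _ "\<pi> * e"]) (auto simp: mult.assoc)
    qed
  qed
qed

text \<open>Write \<open>c * a = p * w\<close>. An irreducible factor of \<open>c\<close> cannot
  divide \<open>p\<close>, since it would be an associate of \<open>p\<close>, which contains
  \<open>y\<close>. So it divides \<open>w\<close> and can be cancelled on both sides.\<close>

lemma irreducible_cancel:
  assumes W: "\<And>\<pi>. Factorial_Ring.irreducible \<pi> \<Longrightarrow> vars \<pi> \<subseteq> V \<Longrightarrow> prime_on W \<pi>"
    and c: "c \<noteq> 0" "vars c \<subseteq> V" and p: "Factorial_Ring.irreducible p" "y \<in> vars p" "y \<notin> V" "vars p \<subseteq> W"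
    and dvd: "p dvd c * a" and a: "vars a \<subseteq> W" "V \<subseteq> W"
  shows "p dvd a"
  using c dvd
proof (induction c rule: proper_dvd_induct)
  case (step c)
  note IH = step.IH and prems = step.prems
  show ?case
  proof (cases "c dvd 1")
    case True
    then show ?thesis using prems by (simp add: unit_iff) auto
  next
    case False
    obtain \<pi> where \<pi>: "Factorial_Ring.irreducible \<pi>" and "\<pi> dvd c"
      using irreducible_divisor[OF step.hyps False] by blast
    then obtain c2 where c2: "c = \<pi> * c2" by (auto elim: dvdE)
    have v: "vars \<pi> \<subseteq> V" "vars c2 \<subseteq> V" using prems(1) step.hyps vars_mult[of \<pi> c2] c2 by auto
    have \<pi>0: "\<pi> \<noteq> 0" and \<pi>1: "\<not> \<pi> dvd 1" using \<pi> by (auto simp: Factorial_Ring.irreducible_def)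
    show ?thesis
    proof (cases "a = 0")
      case False
      obtain w where w: "c * a = p * w" using prems(2) by (auto elim: dvdE)
      have p0: "p \<noteq> 0" "w \<noteq> 0" using w step.hyps False by auto
      have "vars w \<subseteq> vars c \<union> vars a" using vars_mult[OF p0] vars_mult[OF step.hyps False] w by auto
      then have "vars w \<subseteq> W" using prems(1) a by blast
      moreover have "\<pi> dvd p * w" using w c2 by (metis dvd_triv_left mult.assoc)
      moreover have "\<not> \<pi> dvd p"
      proof
        assume "\<pi> dvd p"
        then obtain k where k: "p = \<pi> * k" by (auto elim: dvdE)
        then have "k dvd 1" using p(1) \<pi>1 by (auto simp: Factorial_Ring.irreducible_def)
        then have "vars k = {}" by (auto simp: unit_iff)
        then show False using k p v vars_mult_subset[of \<pi> k] by auto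
      qed
      ultimately have "\<pi> dvd w" using W[OF \<pi> v(1)] p by (auto simp: prime_on_def)
      then obtain w2 where "w = \<pi> * w2" by (auto elim: dvdE)
      then have "c2 * a = p * w2" using w c2 \<pi>0 by (simp add: mult.assoc mult.left_commute)
      then show ?thesis using IH[of c2 \<pi>] c2 \<pi>1 v by (simp add: mult.commute)
    qed auto
  qed
qed

text \<open>Suppose that p divides a * b, that y occurs in p, and let d be of least degree in y in the
  ideal (p, a). Up to factors without y, which cancel by induction, both p and a are multiples
  of d. As p is irreducible, either d is an associate of p, so that p divides a, or d is free of
  y, and then p divides d * b.\<close>

lemma irreducible_prime_on:
  assumes "finite V" "Factorial_Ring.irreducible p" "vars p \<subseteq> V"
  shows "prime_on V p"
  using assms
proof (induction V arbitrary: p rule: finite_induct)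
  case empty
  then obtain c where c: "p = of_int c" by (auto simp: vars_empty_iff)
  have dvd: "of_int a dvd (of_int b :: zpoly) \<longleftrightarrow> a dvd b" for a b
  proof
    assume "of_int a dvd (of_int b :: zpoly)"
    then obtain k where k: "of_int b = of_int a * (k :: zpoly)" by (auto elim: dvdE)
    show "a dvd b"
    proof (cases "b = 0")
      case False
      then have "k \<noteq> 0" "a \<noteq> 0" using k by auto
      then have "vars k = {}" using vars_mult[of "of_int a" k] k by (metis vars_of_int of_int_eq_0_iff Un_empty)
      then obtain l where "k = of_int l" by (auto simp: vars_empty_iff)
      then have "b = a * l" using k by (metis of_int_eq_iff of_int_mult)
      then show ?thesis by simp
    qed auto
  qed (auto elim: dvdE)
  \<comment> \<open>Without variables only the integers are left, where irreducible elements are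
    prime.\<close>
  have "Factorial_Ring.irreducible c"
    unfolding Factorial_Ring.irreducible_def
  proof (intro conjI allI impI)
    show "c \<noteq> 0" "\<not> is_unit c" using empty c dvd[of c 1] by (auto simp: Factorial_Ring.irreducible_def)
    fix a b assume "c = a * b"
    then have "(of_int a :: zpoly) dvd 1 \<or> (of_int b :: zpoly) dvd 1"
      using empty c unfolding Factorial_Ring.irreducible_def by (metis of_int_mult)
    then show "is_unit a \<or> is_unit b" using dvd[of _ 1] by simp
  qed
  then have "prime_elem c" by (rule irreducible_imp_prime_elem)
  then show ?case unfolding prime_on_def
    by (auto simp: vars_empty_iff c dvd prime_elem_dvd_mult_iff simp flip: of_int_mult)
next
  case (insert y V)
  have W: "prime_on (insert y V) \<pi>" if "Factorial_Ring.irreducible \<pi>" "vars \<pi> \<subseteq> V" for \<pi>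
    using insert that by (intro prime_on_insert) auto
  show ?case
  proof (cases "y \<in> vars p")
    case False
    then show ?thesis using W insert.prems by auto
  next
    case y: True
    note cancel = irreducible_cancel[OF W _ _ insert.prems(1) y insert.hyps(2) insert.prems(2)]
    have p0: "p \<noteq> 0" using insert.prems by (auto simp: Factorial_Ring.irreducible_def)
    show ?thesis unfolding prime_on_def
    proof (intro allI impI)
      fix a b assume a: "vars a \<subseteq> insert y V" and b: "vars b \<subseteq> insert y V" and ab: "p dvd a * b"
      let ?J = "{u * p + v * a | u v. vars u \<subseteq> insert y V \<and> vars v \<subseteq> insert y V}"
      have pJ: "p \<in> ?J" by (force intro: exI[of _ 1] exI[of _ 0])
      have aJ: "a \<in> ?J" by (force intro: exI[of _ 1] exI[of _ 0])
      obtain d where d: "d \<in> ?J" "d \<noteq> 0"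
        and quot: "\<And>a. a \<in> ?J \<Longrightarrow> \<exists>c q. c \<noteq> 0 \<and> vars c \<subseteq> V \<and> vars q \<subseteq> insert y V \<and> c * a = q * d"
      proof (rule min_degree_element[of ?J y V p])
        show "vars z \<subseteq> insert y V" if z: "z \<in> ?J" for z
        proof -
          obtain u v where *: "z = u * p + v * a" "vars u \<subseteq> insert y V" "vars v \<subseteq> insert y V" using z by blast
          have "vars (u * p) \<subseteq> insert y V" "vars (v * a) \<subseteq> insert y V"
            using * vars_mult_subset[of u p] vars_mult_subset[of v a] a insert.prems(2) by blast+
          then show ?thesis using vars_add[of "u * p" "v * a"] * by blast
        qed
        show "z + w \<in> ?J" if z: "z \<in> ?J" "w \<in> ?J" for z w
        proof -
          obtain u v u' v' where *: "z = u * p + v * a" "vars u \<subseteq> insert y V" "vars v \<subseteq> insert y V"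
             "w = u' * p + v' * a" "vars u' \<subseteq> insert y V" "vars v' \<subseteq> insert y V" using z by blast
          then have "z + w = (u + u') * p + (v + v') * a" by (simp add: algebra_simps)
          moreover have "vars (u + u') \<subseteq> insert y V" "vars (v + v') \<subseteq> insert y V" using * vars_add by blast+
          ultimately show ?thesis by blast
        qed
        show "r * z \<in> ?J" if z: "z \<in> ?J" "vars r \<subseteq> insert y V" for z r
        proof -
          obtain u v where *: "z = u * p + v * a" "vars u \<subseteq> insert y V" "vars v \<subseteq> insert y V" using z by blast
          then have "r * z = (r * u) * p + (r * v) * a" by (simp add: algebra_simps)
          moreover have "vars (r * u) \<subseteq> insert y V" "vars (r * v) \<subseteq> insert y V" using * z vars_mult_subset by blast+
          ultimately show ?thesis by blast
        qed
      qed (use insert pJ p0 in auto)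
      obtain u v where uv: "d = u * p + v * a" "vars u \<subseteq> insert y V" "vars v \<subseteq> insert y V" using d by blast
      have vd: "vars d \<subseteq> insert y V"
        using uv vars_mult_subset[of u p] vars_mult_subset[of v a] a insert.prems(2) vars_add[of "u * p" "v * a"] by blast
      obtain c q where c: "c \<noteq> 0" "vars c \<subseteq> V" "vars q \<subseteq> insert y V" "c * p = q * d" using quot[OF pJ] by blast
      obtain c' q' where c': "c' \<noteq> 0" "vars c' \<subseteq> V" "vars q' \<subseteq> insert y V" "c' * a = q' * d" using quot[OF aJ] by blast
      obtain q1 d1 e where f: "p = q1 * d1" "d = e * d1" "vars e \<subseteq> V"
        using prime_on_cancel[OF W c(1,2,4) p0 c(3) vd] by blast
      \<comment> \<open>Once the multiplier \<open>c\<close> has been cancelled,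
        \<open>p = q1 * d1\<close> is a factorization to which the irreducibility of
        \<open>p\<close> applies.\<close>
      have "q1 dvd 1 \<or> d1 dvd 1" using insert.prems f by (auto simp: Factorial_Ring.irreducible_def)
      then show "p dvd a \<or> p dvd b"
      proof
        assume "d1 dvd 1"
        then have "vars d1 = {}" by (auto simp: unit_iff)
        then have "vars d \<subseteq> V" using f vars_mult_subset[of e d1] by auto
        moreover have "p dvd d * b" 
        proof -
          have "d * b = p * (u * b) + v * (a * b)" using uv by (simp add: algebra_simps)
          then show ?thesis using ab by (simp add: dvd_add)
        qed
        ultimately have "p dvd b" using cancel[of d b] d b by auto
        then show ?thesis ..
      next
        assume "q1 dvd 1"
        then have "p dvd d1" using f by (auto simp: unit_iff)
        then have "p dvd c' * a" using f c' by auto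
        then have "p dvd a" using cancel[of c' a] c' a by auto
        then show ?thesis ..
      qed
    qed
  qed
qed

lemma irreducible_dvd_mult:
  assumes "Factorial_Ring.irreducible (p :: zpoly)" "p dvd a * b"
  shows "p dvd a \<or> p dvd b"
  using irreducible_prime_on[of "vars p \<union> vars a \<union> vars b" p] assms by (auto simp: prime_on_def)

lemma irreducible_dvd_prod:
  assumes "Factorial_Ring.irreducible (p :: zpoly)" "p dvd prod g A"
  shows "\<exists>a\<in>A. p dvd g a"
  using assms(2)
proof (induction A rule: infinite_finite_induct)
  case (insert a A)
  then show ?case using irreducible_dvd_mult[OF assms(1), of "g a" "prod g A"] by auto
qed (use assms in \<open>auto simp: Factorial_Ring.irreducible_def\<close>)

section \<open>Greatest common divisors\<close>

text \<open>If no irreducible polynomial divides all of \<open>A\<close>, every common divisor is a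
  unit and \<open>1\<close> is a gcd. Otherwise such a \<open>\<pi>\<close> is split off from all
  elements at once. The process ends, even for infinite \<open>A\<close>, because the fixed nonzero
  element \<open>a\<close> loses a factor each time.\<close>

lemma gcd_exists:
  assumes "a \<in> A" "a \<noteq> (0 :: zpoly)"
  shows "\<exists>d. (\<forall>p\<in>A. d dvd p) \<and> (\<forall>e. (\<forall>p\<in>A. e dvd p) \<longrightarrow> e dvd d)"
  using assms(2,1)
proof (induction a arbitrary: A rule: proper_dvd_induct)
  case (step a)
  show ?case
  proof (cases "\<exists>\<pi>. Factorial_Ring.irreducible \<pi> \<and> (\<forall>p\<in>A. \<pi> dvd p)")
    case False
    have "e dvd 1" if e: "\<forall>p\<in>A. e dvd p" for e
    proof (rule ccontr)
      assume "\<not> e dvd 1"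
      moreover have "e \<noteq> 0" using e step by auto
      ultimately obtain \<pi> where "Factorial_Ring.irreducible \<pi>" "\<pi> dvd e" using irreducible_divisor by blast
      then show False using False e dvd_trans by blast
    qed
    then show ?thesis by (intro exI[of _ 1]) auto
  next
    case True
    then obtain \<pi> where \<pi>: "Factorial_Ring.irreducible \<pi>" "\<forall>p\<in>A. \<pi> dvd p" by blast
    have \<pi>0: "\<pi> \<noteq> 0" and \<pi>1: "\<not> \<pi> dvd 1" using \<pi> by (auto simp: Factorial_Ring.irreducible_def)
    define B where "B = {b. \<pi> * b \<in> A}"
    obtain a2 where a2: "a = \<pi> * a2" using \<pi> step.prems by (auto elim: dvdE)
    then have "a2 \<in> B" using step.prems by (auto simp: B_def)
    then obtain d where d: "\<forall>p\<in>B. d dvd p" "\<forall>e. (\<forall>p\<in>B. e dvd p) \<longrightarrow> e dvd d"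
      using step.IH[of a2 \<pi> B] a2 \<pi>1 by (auto simp: mult.commute)
    have "e dvd \<pi> * d" if e: "\<forall>p\<in>A. e dvd p" for e
    proof (cases "\<pi> dvd e")
      case True
      then obtain e2 where e2: "e = \<pi> * e2" by (auto elim: dvdE)
      have "e2 dvd b" if b: "b \<in> B" for b
      proof -
        have "\<pi> * e2 dvd \<pi> * b" using e e2 b by (auto simp: B_def)
        then obtain k where "\<pi> * b = \<pi> * e2 * k" by (rule dvdE)
        then have "b = e2 * k" using \<pi>0 by (simp add: mult.assoc)
        then show ?thesis by simp
      qed
      then have "e2 dvd d" using d(2) by blast
      then show ?thesis using e2 by (auto simp: mult_dvd_mono)
    next
      case False
      have "e dvd b" if b: "b \<in> B" for b
      proof -
        have "e dvd \<pi> * b" using e b by (auto simp: B_def)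
        then obtain k where k: "\<pi> * b = e * k" by (rule dvdE)
        then have "\<pi> dvd k" using irreducible_dvd_mult[OF \<pi>(1), of e k] False by (metis dvd_triv_left)
        then obtain k2 where "k = \<pi> * k2" by (auto elim: dvdE)
        then have "b = e * k2" using k \<pi>0 by (simp add: mult.left_commute)
        then show ?thesis by simp
      qed
      then show ?thesis using d by auto
    qed
    moreover have "\<pi> * d dvd p" if p: "p \<in> A" for p
    proof -
      obtain b where b: "p = \<pi> * b" using \<pi> p by (auto elim: dvdE)
      then show ?thesis using d p by (auto simp: B_def)
    qed
    ultimately show ?thesis by blast
  qed
qed

lemma lcoeff_uminus: "lcoeff (- p) = - lcoeff p"
  by (simp add: lcoeff_def)

lemma lcoeff_eq_0_iff: "lcoeff p = 0 \<longleftrightarrow> p = 0"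
  using Max_in[of "Poly_Mapping.keys p"] by (auto simp: lcoeff_def in_keys_iff)

text \<open>Associates differ only by a sign, so the condition on \<open>lcoeff\<close> selects one
  of them. This gives the uniqueness behind \<open>mgcd\<close>.\<close>

lemma normalized_eqI:
  assumes "p dvd q" "q dvd p" "lcoeff p > 0" "lcoeff q > 0"
  shows "p = q"
proof -
  obtain k where k1: "q = p * k" using assms(1) by (rule dvdE)
  obtain l where k2: "p = q * l" using assms(2) by (rule dvdE)
  note k = k1 k2
  have "p \<noteq> 0" using assms lcoeff_eq_0_iff[of p] by auto
  moreover have "p = p * (k * l)" using k by (metis mult.assoc)
  ultimately have "k * l = 1" by simp
  then have "k dvd 1" by (metis dvd_triv_left)
  then show ?thesis using k assms by (auto simp: unit_iff lcoeff_uminus)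
qed

lemma mgcd:
  assumes "a \<in> A" "a \<noteq> 0"
  shows "\<And>p. p \<in> A \<Longrightarrow> mgcd A dvd p" and "\<And>e. (\<And>p. p \<in> A \<Longrightarrow> e dvd p) \<Longrightarrow> e dvd mgcd A"
    and "mgcd A \<noteq> 0"
proof -
  let ?P = "\<lambda>d. (\<forall>p\<in>A. d dvd p) \<and> (\<forall>e. (\<forall>p\<in>A. e dvd p) \<longrightarrow> e dvd d) \<and> (d = 0 \<or> lcoeff d > 0)"
  obtain d where d: "\<forall>p\<in>A. d dvd p" "\<forall>e. (\<forall>p\<in>A. e dvd p) \<longrightarrow> e dvd d" using gcd_exists[OF assms] by blast
  have "\<exists>d. ?P d"
  proof (cases "lcoeff d > 0 \<or> d = 0")
    case True
    then show ?thesis using d by (intro exI[of _ d]) auto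
  next
    case False
    then have "lcoeff (- d) > 0" using lcoeff_eq_0_iff[of d] by (simp add: lcoeff_uminus)
    then show ?thesis using d by (intro exI[of _ "- d"]) auto
  qed
  moreover have "d = d'" if "?P d" "?P d'" for d d'
  proof -
    have "d \<noteq> 0" "d' \<noteq> 0" using that assms by auto
    then show ?thesis using that by (intro normalized_eqI) auto
  qed
  ultimately have "?P (mgcd A)" unfolding mgcd_def by (rule theI'[OF ex_ex1I])
  then show "\<And>p. p \<in> A \<Longrightarrow> mgcd A dvd p" "\<And>e. (\<And>p. p \<in> A \<Longrightarrow> e dvd p) \<Longrightarrow> e dvd mgcd A" "mgcd A \<noteq> 0"
    using assms by auto
qed

text \<open>All \<open>e\<close>, in particular \<open>0\<close>, divide \<open>0\<close>, and a gcd
  must be divisible by each of them. This case carries the zero polynomial through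
  \<open>Hp\<close>.\<close>

lemma mgcd_0: "mgcd {0} = 0"
  unfolding mgcd_def by (rule the_equality) (auto dest: spec[of _ 0])

section \<open>Elimination of a variable from an ideal\<close>

text \<open>Each factorization passes \<open>P\<close> on to one of the factors, and units do not
  have it, so the descent ends in an irreducible factor. It is used for the properties of containing
  a given variable and of vanishing at a given point.\<close>

lemma irreducible_divisor_with:
  assumes h: "h \<noteq> (0 :: zpoly)" "P h" and mult: "\<And>a b. P (a * b) \<Longrightarrow> P a \<or> P b" and unit: "\<And>u. u dvd 1 \<Longrightarrow> \<not> P u"
  obtains \<pi> where "Factorial_Ring.irreducible \<pi>" "\<pi> dvd h" "P \<pi>"
proof -
  have "\<exists>\<pi>. Factorial_Ring.irreducible \<pi> \<and> \<pi> dvd h \<and> P \<pi>" using h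
  proof (induction h rule: proper_dvd_induct)
    case (step h)
    show ?case
    proof (cases "Factorial_Ring.irreducible h")
      case True
      then show ?thesis using step.prems by auto
    next
      case False
      moreover have "\<not> h dvd 1" using unit step.prems by auto
      ultimately obtain q r where qr: "h = q * r" "\<not> q dvd 1" "\<not> r dvd 1"
        using step.hyps by (auto simp: Factorial_Ring.irreducible_def)
      then consider "P q" | "P r" using mult step.prems by blast
      then show ?thesis
      proof cases
        case 1
        then show ?thesis using step.IH[of q r] qr by (auto intro: dvd_mult2)
      next
        case 2
        then show ?thesis using step.IH[of r q] qr by (auto simp: mult.commute intro: dvd_mult)
      qed
    qed
  qed
  then show ?thesis using that by blast
qed

text \<open>Let \<open>d\<close> have least degree in \<open>y\<close> in the ideal
  \<open>J\<close>. If \<open>y\<close> occurred in \<open>d\<close>, an irreducible factor of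
  \<open>d\<close> containing \<open>y\<close> would divide \<open>c * a\<close> for each
  \<open>a\<close> in \<open>J\<close> with some nonzero \<open>c\<close> free of \<open>y\<close>.
  It cannot divide \<open>c\<close>, so it would be a common factor of \<open>J\<close>.\<close>

lemma elimination:
  assumes J: "a0 \<in> J" "a0 \<noteq> 0" "\<And>a b. a \<in> J \<Longrightarrow> b \<in> J \<Longrightarrow> a + b \<in> J" "\<And>a r. a \<in> J \<Longrightarrow> r * a \<in> J"
    and cop: "\<And>\<pi>. Factorial_Ring.irreducible \<pi> \<Longrightarrow> y \<in> vars \<pi> \<Longrightarrow> \<exists>a\<in>J. \<not> \<pi> dvd a"
  obtains R where "R \<in> J" "R \<noteq> 0" "y \<notin> vars R"
proof -
  obtain d where d: "d \<in> J" "d \<noteq> 0"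
    and quot: "\<And>a. a \<in> J \<Longrightarrow> \<exists>c q. c \<noteq> 0 \<and> vars c \<subseteq> - {y} \<and> vars q \<subseteq> insert y (- {y}) \<and> c * a = q * d"
    by (rule min_degree_element[of J y "- {y}" a0]) (use J in auto)
  have "y \<notin> vars d"
  proof
    assume "y \<in> vars d"
    then obtain \<pi> where \<pi>: "Factorial_Ring.irreducible \<pi>" "\<pi> dvd d" "y \<in> vars \<pi>"
      by (rule irreducible_divisor_with[of d "\<lambda>p. y \<in> vars p", OF d(2)]) (use vars_mult_subset in \<open>auto simp: unit_iff\<close>)
    have "\<pi> dvd a" if a: "a \<in> J" for a
    proof -
      obtain c q where c: "c \<noteq> 0" "vars c \<subseteq> - {y}" "c * a = q * d" using quot[OF a] by blast
      then have "\<pi> dvd c * a" using \<pi> by auto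
      moreover have "\<not> \<pi> dvd c" using vars_dvd[of \<pi> c] c \<pi> by auto
      ultimately show ?thesis using irreducible_dvd_mult \<pi> by blast
    qed
    then show False using cop \<pi> by blast
  qed
  then show ?thesis using that d by blast
qed

text \<open>The elimination is carried out in the ideal of all polynomials vanishing on the common
  real zeros of \<open>A\<close>. It contains \<open>A\<close>, and membership in it is exactly the
  property required of \<open>R\<close>.\<close>

lemma elimination_zeros:
  assumes A: "a0 \<in> A" "a0 \<noteq> 0"
    and cop: "\<And>e. (\<And>a. a \<in> A \<Longrightarrow> e dvd a) \<Longrightarrow> e dvd 1"
  obtains R where "R \<noteq> 0" "y \<notin> vars R" "\<And>x. (\<And>a. a \<in> A \<Longrightarrow> meval x a = 0) \<Longrightarrow> meval x R = 0"
proof (rule elimination[of a0 "{z. \<forall>x. (\<forall>a\<in>A. meval x a = 0) \<longrightarrow> meval x z = 0}" y])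
  fix \<pi> :: zpoly assume "Factorial_Ring.irreducible \<pi>"
  then have "\<not> (\<forall>a\<in>A. \<pi> dvd a)" using cop[of \<pi>] unfolding Factorial_Ring.irreducible_def by blast
  then show "\<exists>a\<in>{z. \<forall>x. (\<forall>a\<in>A. meval x a = 0) \<longrightarrow> meval x z = 0}. \<not> \<pi> dvd a" by blast
qed (use A that in auto)


subsection \<open>Nonvanishing points\<close>

lemma continuous_on_meval [continuous_intros]: "continuous_on A (\<lambda>x. meval x p)"
  unfolding meval_def
  by (intro continuous_intros continuous_on_subset[OF continuous_on_product_coordinates]) auto

lemma continuous_on_upd: "continuous_on A (\<lambda>t. (x :: nat \<Rightarrow> real)(y := t))"
proof (rule continuous_on_coordinatewise_then_product)
  fix i show "continuous_on A (\<lambda>t. (x(y := t)) i)" by (cases "i = y") (auto intro: continuous_intros)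
qed

text \<open>By induction some point of \<open>W\<close> is not a zero of the leading coefficient in
  \<open>y\<close>. The line in direction \<open>y\<close> through it contains finitely many zeros
  of \<open>R\<close>, but meets \<open>W\<close> in a nonempty open set of parameters.\<close>

lemma nonvanishing_dense:
  assumes "R \<noteq> 0" "open W" "a \<in> W"
  shows "\<exists>x\<in>W. meval x R \<noteq> 0"
  using assms(1)
proof (induction "card (vars R)" arbitrary: R rule: less_induct)
  case less
  show ?case
  proof (cases "vars R = {}")
    case True
    then show ?thesis using assms(3) less.prems by (auto simp: vars_empty_iff)
  next
    case False
    then obtain y where y: "y \<in> vars R" by blast
    define L where "L = lead_coeff (to_upoly y R)"
    have L0: "L \<noteq> 0" using less.prems by (simp add: L_def)
    have "vars L \<subset> vars R" using vars_coeff[of y R] y unfolding L_def by blast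
    then have "card (vars L) < card (vars R)" by (intro psubset_card_mono) auto
    then obtain x where x: "x \<in> W" "meval x L \<noteq> 0" using less.hyps L0 by blast
    define P where "P = map_poly (meval x) (to_upoly y R)"
    have "Polynomial.coeff P (dg y R) \<noteq> 0" using x by (simp add: P_def L_def dg_def coeff_map_poly)
    then have "P \<noteq> 0" by auto
    then have "finite {t. poly P t = 0}" by (rule poly_roots_finite)
    moreover have "open ((\<lambda>t. x(y := t)) -` W)"
      by (intro open_vimage assms continuous_on_upd)
    moreover have "x y \<in> (\<lambda>t. x(y := t)) -` W" using x by simp
    ultimately obtain t where "x(y := t) \<in> W" "poly P t \<noteq> 0"
      using finite_imp_not_open finite_subset by (metis (mono_tags, lifting) empty_iff mem_Collect_eq subsetI vimageE)
    then show ?thesis by (auto simp: P_def simp flip: meval_upd)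
  qed
qed

lemma nonvanishing_point:
  assumes "R \<noteq> 0" obtains x where "meval x R \<noteq> 0"
  using nonvanishing_dense[OF assms open_UNIV] by auto

subsection \<open>The squarefree part\<close>

definition fac :: "zpoly \<Rightarrow> zpoly set" where
  "fac h = {p. Factorial_Ring.irreducible p \<and> primitive_poly p \<and> \<not> const_poly p \<and> lcoeff p > 0 \<and> p dvd h}"

lemma sqrf_eq: "vars h \<noteq> {} \<Longrightarrow> sqrf h = \<Prod>(fac h)"
  by (simp add: sqrf_def fac_def const_poly_iff)

lemma irreducible_dvd_imp_dvd:
  assumes "Factorial_Ring.irreducible (p :: zpoly)" "Factorial_Ring.irreducible q" "p dvd q"
  shows "q dvd p"
proof -
  obtain k where k: "q = p * k" using assms(3) by (rule dvdE)
  then have "k dvd 1" using assms by (auto simp: Factorial_Ring.irreducible_def)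
  then show ?thesis using k by (auto simp: unit_iff)
qed

lemma fac_eqI: "p \<in> fac h \<Longrightarrow> q \<in> fac h' \<Longrightarrow> p dvd q \<Longrightarrow> p = q"
  by (auto simp: fac_def intro!: normalized_eqI dest: irreducible_dvd_imp_dvd)

text \<open>The product in \<open>sqrf\<close> would default to \<open>1\<close> over an infinite
  set. Splitting an irreducible factor off \<open>h\<close> accounts for at most one element of
  \<open>fac h\<close>.\<close>

lemma finite_fac: "h \<noteq> 0 \<Longrightarrow> finite (fac h)"
proof (induction h rule: proper_dvd_induct)
  case (step h)
  show ?case
  proof (cases "h dvd 1")
    case True
    then have "fac h = {}" by (auto simp: fac_def Factorial_Ring.irreducible_def dest: dvd_trans)
    then show ?thesis by simp
  next
    case False
    obtain \<pi> where \<pi>: "Factorial_Ring.irreducible \<pi>" "\<pi> dvd h" using irreducible_divisor[OF step.hyps False] .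
    obtain h2 where h2: "h = \<pi> * h2" using \<pi>(2) by (rule dvdE)
    have "fac h \<subseteq> fac h2 \<union> fac \<pi>" using irreducible_dvd_mult unfolding h2 fac_def by blast
    moreover have "finite (fac h2)" using step.IH[of h2 \<pi>] h2 \<pi> by (auto simp: mult.commute Factorial_Ring.irreducible_def)
    moreover have "p = q" if pq: "p \<in> fac \<pi>" "q \<in> fac \<pi>" for p q
    proof (rule fac_eqI[OF pq])
      have "p dvd \<pi>" "\<pi> dvd q" using pq \<pi> irreducible_dvd_imp_dvd[of q \<pi>] by (auto simp: fac_def)
      then show "p dvd q" by (rule dvd_trans)
    qed
    then have "finite (fac \<pi>)" by (metis finite.simps subsetI finite_subset insertI1 equals0I)
    ultimately show ?thesis using finite_subset by blast
  qed
qed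

lemma fac_dvd_prod:
  assumes "p \<in> fac h" "S \<subseteq> fac h" "p dvd \<Prod>S"
  shows "p \<in> S"
proof -
  have "Factorial_Ring.irreducible p" using assms by (simp add: fac_def)
  then obtain q where "q \<in> S" "p dvd q" using irreducible_dvd_prod[of p "\<lambda>x. x" S] assms by auto
  then show ?thesis using fac_eqI[of p h q h] assms by auto
qed

text \<open>Distinct elements of \<open>fac h\<close> are not associated, so by primality each new
  one divides the cofactor left by the others.\<close>

lemma prod_fac_dvd: "finite S \<Longrightarrow> S \<subseteq> fac h \<Longrightarrow> \<Prod>S dvd h"
proof (induction S rule: finite_induct)
  case (insert p S)
  obtain k where k: "h = \<Prod>S * k" using insert by (auto elim: dvdE)
  have p: "Factorial_Ring.irreducible p" "p dvd \<Prod>S * k" using insert.prems k by (auto simp: fac_def)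
  then have "p dvd \<Prod>S \<or> p dvd k" by (rule irreducible_dvd_mult)
  moreover have "\<not> p dvd \<Prod>S" using fac_dvd_prod[of p h S] insert by auto
  ultimately have "\<Prod>S * p dvd \<Prod>S * k" by (intro mult_dvd_mono) auto
  then show ?case using insert k by (simp add: mult.commute)
qed simp

lemma sqrf_dvd: "h \<noteq> 0 \<Longrightarrow> sqrf h dvd h"
  using prod_fac_dvd[OF finite_fac, of h h] sqrf_eq[of h] by (cases "vars h = {}") (auto simp: sqrf_def const_poly_iff)

lemma fac_dvd_sqrf: "h \<noteq> 0 \<Longrightarrow> p \<in> fac h \<Longrightarrow> p dvd sqrf h"
proof -
  assume *: "h \<noteq> 0" "p \<in> fac h"
  then have "vars h \<noteq> {}" using vars_dvd[of p h] by (auto simp: fac_def const_poly_iff)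
  then show ?thesis using * finite_fac by (auto simp: sqrf_eq intro: dvd_prod_eqI)
qed

text \<open>An irreducible polynomial with a variable is primitive, as the cofactor of an integer
  divisor still contains the variable and is no unit. Only the sign of \<open>\<pi>\<close> has to
  be adjusted.\<close>

lemma fac_normalize:
  assumes "Factorial_Ring.irreducible \<pi>" "\<pi> dvd h" "vars \<pi> \<noteq> {}"
  shows "\<pi> \<in> fac h \<or> - \<pi> \<in> fac h"
proof -
  have irr: "Factorial_Ring.irreducible (- \<pi>)"
    unfolding Factorial_Ring.irreducible_def
  proof (intro conjI allI impI)
    show "- \<pi> \<noteq> 0" "\<not> - \<pi> dvd 1" using assms(1) by (auto simp: Factorial_Ring.irreducible_def)
    fix a b assume "- \<pi> = a * b"
    then have "\<pi> = (- a) * b" by (metis minus_minus minus_mult_left)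
    then show "a dvd 1 \<or> b dvd 1" using assms(1) unfolding Factorial_Ring.irreducible_def by (metis minus_dvd_iff)
  qed
  have prim: "primitive_poly \<pi>"
    unfolding primitive_poly_def
  proof (intro allI impI)
    fix c :: int assume "of_int c dvd \<pi>"
    then obtain k where k: "\<pi> = of_int c * k" by (rule dvdE)
    then have "vars k \<noteq> {}" using assms(3) vars_mult_subset[of "of_int c" k] by auto
    then have "\<not> k dvd 1" by (auto simp: unit_iff)
    then have "(of_int c :: zpoly) dvd 1" using k assms(1) by (auto simp: Factorial_Ring.irreducible_def)
    then have "(of_int c :: zpoly) = of_int 1 \<or> (of_int c :: zpoly) = of_int (- 1)" unfolding unit_iff by simp
    then have "c = 1 \<or> c = - 1" unfolding of_int_eq_iff .
    then show "is_unit c" by auto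
  qed
  then have prim': "primitive_poly (- \<pi>)" by (simp add: primitive_poly_def)
  have "lcoeff \<pi> \<noteq> 0" using assms(1) by (auto simp: lcoeff_eq_0_iff Factorial_Ring.irreducible_def)
  then show ?thesis using assms irr prim prim' by (auto simp: fac_def lcoeff_uminus const_poly_iff)
qed

lemma sqrf_nonzero: "h \<noteq> 0 \<Longrightarrow> sqrf h \<noteq> 0"
  using sqrf_dvd[of h] by auto

lemma vars_sqrf: assumes "h \<noteq> 0" shows "vars (sqrf h) = vars h"
proof
  show "vars (sqrf h) \<subseteq> vars h" using vars_dvd[OF sqrf_dvd[OF assms] assms] .
  show "vars h \<subseteq> vars (sqrf h)"
  proof
    fix y assume y: "y \<in> vars h"
    obtain \<pi> where \<pi>: "Factorial_Ring.irreducible \<pi>" "\<pi> dvd h" "y \<in> vars \<pi>"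
      by (rule irreducible_divisor_with[of h "\<lambda>p. y \<in> vars p", OF assms y]) (use vars_mult_subset in \<open>auto simp: unit_iff\<close>)
    then consider "\<pi> \<in> fac h" | "- \<pi> \<in> fac h" using fac_normalize[of \<pi> h] by auto
    then have "\<pi> dvd sqrf h" using fac_dvd_sqrf[OF assms] by cases force+
    then show "y \<in> vars (sqrf h)" using vars_dvd[OF _ sqrf_nonzero[OF assms]] \<pi> by auto
  qed
qed

text \<open>A zero of \<open>h\<close> is a zero of one of its irreducible factors. That factor
  contains a variable, because nonzero integers do not vanish, and so up to sign it occurs in
  \<open>sqrf h\<close>.\<close>

lemma meval_sqrf_eq_0_iff:
  assumes "h \<noteq> 0" "vars h \<noteq> {}"
  shows "meval x (sqrf h) = 0 \<longleftrightarrow> meval x h = 0"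
proof
  assume "meval x (sqrf h) = 0"
  then show "meval x h = 0" using sqrf_dvd[OF assms(1)] by (metis dvdE meval_mult mult_zero_left)
next
  assume 0: "meval x h = 0"
  obtain \<pi> where \<pi>: "Factorial_Ring.irreducible \<pi>" "\<pi> dvd h" "meval x \<pi> = 0"
    by (rule irreducible_divisor_with[of h "\<lambda>p. meval x p = 0", OF assms(1) 0]) (auto simp: unit_iff)
  have "vars \<pi> \<noteq> {}"
  proof
    assume "vars \<pi> = {}"
    then obtain c where "\<pi> = of_int c" by (auto simp: vars_empty_iff)
    then show False using \<pi> by (auto simp: Factorial_Ring.irreducible_def)
  qed
  then consider "\<pi> \<in> fac h" | "- \<pi> \<in> fac h" using fac_normalize[of \<pi> h] \<pi> by auto
  then have "\<pi> dvd sqrf h" using fac_dvd_sqrf[OF assms(1)] by cases force+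
  then show "meval x (sqrf h) = 0" using \<pi> by (metis dvdE meval_mult mult_zero_left)
qed

subsection \<open>Brown projection\<close>

lemma vars_resultant:
  assumes P: "\<And>i. vars (Polynomial.coeff P i) \<subseteq> V" and Q: "\<And>i. vars (Polynomial.coeff Q i) \<subseteq> V"
  shows "vars (resultant P Q) \<subseteq> V"
proof -
  let ?n = "Polynomial.degree P + Polynomial.degree Q"
  have e: "vars (sylvester_mat P Q $$ (i, j)) \<subseteq> V" if "i < ?n" "j < ?n" for i j
    using that P Q by (auto simp: sylvester_index_mat)
  show ?thesis
    unfolding resultant_def det_def'[OF sylvester_carrier_mat]
  proof (intro vars_sum_subset vars_leI vars_prod_subset)
    fix p assume p: "p \<in> {p. p permutes {0..<?n}}"
    show "vars (signof p) \<subseteq> V" by (simp add: sign_def)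
    fix i assume "i \<in> {0..<?n}"
    then show "vars (sylvester_mat P Q $$ (i, p i)) \<subseteq> V" using p permutes_in_image by (intro e) fastforce+
  qed
qed

lemma vars_coeff_pderiv:
  assumes "\<And>i. vars (Polynomial.coeff P i) \<subseteq> V"
  shows "vars (Polynomial.coeff (pderiv P) i) \<subseteq> V"
  unfolding coeff_pderiv
  by (intro vars_leI assms) (metis empty_subsetI of_int_of_nat_eq vars_of_int)

lemma vars_Bp:
  assumes "h \<noteq> 0"
  shows "vars (Bp h y) \<subseteq> vars h - {y}"
proof (cases "y \<in> vars h")
  case False
  then show ?thesis using dg_pos_iff[of y h] by (auto simp: Bp_def dg_def)
next
  case True
  have "vars (Polynomial.coeff (to_upoly y (sqrf h)) i) \<subseteq> vars h - {y}" for i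
    using vars_coeff[of y "sqrf h" i] vars_sqrf[OF assms] by simp
  then show ?thesis using True dg_pos_iff[of y h]
    by (auto simp: Bp_def dg_def intro!: vars_resultant vars_coeff_pderiv del: subsetI)
qed

lemma Bp_eq:
  "y \<in> vars h \<Longrightarrow> Bp h y = resultant (to_upoly y (sqrf h)) (pderiv (to_upoly y (sqrf h)))"
  using dg_pos_iff[of y h] by (simp add: Bp_def dg_def)

lemma Bp_free: "y \<notin> vars h \<Longrightarrow> Bp h y = h"
  using dg_pos_iff[of y h] by (simp add: Bp_def dg_def)

interpretation meval_poly: map_poly_comm_ring_hom "meval x" for x ..

lemma map_poly_meval_pderiv: "map_poly (meval x) (pderiv P) = pderiv (map_poly (meval x) P)"
  by (rule poly_eqI) (simp add: coeff_map_poly coeff_pderiv meval.hom_add meval.hom_of_nat)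

lemma degree_map_poly_meval:
  assumes "meval x (lead_coeff P) \<noteq> 0"
  shows "Polynomial.degree (map_poly (meval x) P) = Polynomial.degree P"
  using assms by (intro degree_map_poly) auto

text \<open>If the leading coefficient survives evaluation, the degrees of \<open>P\<close> and, in
  characteristic 0, of \<open>pderiv P\<close> are kept, so both Sylvester matrices have the same
  size.\<close>

lemma resultant_pderiv_specialize:
  assumes lc: "meval x (lead_coeff P) \<noteq> 0"
  shows "resultant (map_poly (meval x) P) (pderiv (map_poly (meval x) P)) = meval x (resultant P (pderiv P))"
proof -
  note d = degree_map_poly_meval[OF lc]
  have "Polynomial.degree (map_poly (meval x) (pderiv P)) = Polynomial.degree (pderiv P)"
    by (simp add: map_poly_meval_pderiv degree_pderiv d)
  then show ?thesis using meval.resultant_map_poly[OF d] by (metis map_poly_meval_pderiv)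
qed

text \<open>The first column of the Sylvester matrix has no entries besides 0 and the leading
  coefficients of \<open>P\<close> and \<open>pderiv P\<close>, and the latter is a multiple of the
  former.\<close>

lemma resultant_pderiv_lead_coeff:
  assumes P: "Polynomial.degree P > 0" and lc: "meval x (lead_coeff P) = 0"
  shows "meval x (resultant P (pderiv P)) = 0"
proof -
  let ?Q = "pderiv P"
  let ?n = "Polynomial.degree P + Polynomial.degree ?Q"
  let ?M = "map_mat (meval x) (sylvester_mat P ?Q)"
  have Q: "Polynomial.degree ?Q = Polynomial.degree P - 1" by (rule degree_pderiv)
  have lcQ: "meval x (lead_coeff ?Q) = 0"
    using lc P by (simp add: Q coeff_pderiv)
  have col: "?M $$ (i, 0) = 0" if i: "i < ?n" for i
  proof (cases "i < Polynomial.degree ?Q")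
    case True
    then show ?thesis using P lc i by (cases "i = 0") (auto simp: sylvester_index_mat)
  next
    case False
    then show ?thesis using P lcQ i by (cases "i = Polynomial.degree ?Q") (auto simp: sylvester_index_mat)
  qed
  have "meval x (resultant P ?Q) = det ?M" by (simp add: resultant_def meval.hom_det)
  also have "\<dots> = (\<Sum>i<?n. ?M $$ (i, 0) * cofactor ?M i 0)"
    by (rule laplace_expansion_column) (use P in \<open>auto intro: sylvester_carrier_mat\<close>)
  also have "\<dots> = 0" by (intro sum.neutral) (simp add: col del: index_map_mat)
  finally show ?thesis .
qed

text \<open>The nonvanishing leading coefficient lets the resultant commute with evaluation; a
  multiple root of \<open>F\<close> would be a common root of \<open>F\<close> and its derivative
  and make that resultant 0.\<close>

lemma Bp_nonzero_imp:
  assumes y: "y \<in> vars h" "h \<noteq> 0" and nz: "meval x (Bp h y) \<noteq> 0"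
  defines "F \<equiv> map_poly (meval x) (to_upoly y (sqrf h))"
  shows "meval x (lead_coeff (to_upoly y (sqrf h))) \<noteq> 0" and "poly F t = 0 \<Longrightarrow> poly (pderiv F) t \<noteq> 0"
proof -
  have deg: "Polynomial.degree (to_upoly y (sqrf h)) > 0"
    using y by (simp add: vars_sqrf dg_pos_iff flip: dg_def)
  show lc: "meval x (lead_coeff (to_upoly y (sqrf h))) \<noteq> 0"
    using resultant_pderiv_lead_coeff[OF deg] nz y by (auto simp: Bp_eq)
  have "resultant F (pderiv F) \<noteq> 0"
    unfolding F_def resultant_pderiv_specialize[OF lc] using nz y by (simp add: Bp_eq)
  then have g: "Polynomial.degree (gcd F (pderiv F)) = 0" by (simp add: resultant_0_gcd)
  have F0: "F \<noteq> 0" using deg degree_map_poly_meval[OF lc] by (auto simp: F_def)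
  show "poly (pderiv F) t \<noteq> 0" if "poly F t = 0"
  proof
    assume "poly (pderiv F) t = 0"
    then have "[:- t, 1:] dvd gcd F (pderiv F)" using that by (simp add: poly_eq_0_iff_dvd)
    then have "Polynomial.degree [:- t, 1:] \<le> Polynomial.degree (gcd F (pderiv F))"
      using F0 by (intro dvd_imp_degree_le) auto
    then show False using g by simp
  qed
qed

text \<open>This is the partial derivative, brought back to \<open>zpoly\<close> so that it can
  serve as an ideal generator and as a continuous function on the space of sequences.\<close>

definition deriv_in :: "nat \<Rightarrow> zpoly \<Rightarrow> zpoly" where
  "deriv_in y p = poly (pderiv (to_upoly y p)) (X y)"

lemma to_upoly_deriv_in: "to_upoly y (deriv_in y p) = pderiv (to_upoly y p)"
  unfolding deriv_in_def using vars_coeff[of y p] vars_coeff_pderiv[of "to_upoly y p" "- {y}"]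
  by (intro to_upoly_poly_X) blast

text \<open>The squarefree part and its partial derivative share no irreducible factor containing
  \<open>y\<close>, so elimination yields a nonzero combination \<open>R\<close> of them without
  \<open>y\<close>. At a point off the zeros of \<open>R\<close> and of the leading coefficient, the
  specialized resultant is nonzero.\<close>

lemma Bp_nonzero:
  assumes h: "h \<noteq> 0"
  shows "Bp h y \<noteq> 0"
proof (cases "y \<in> vars h")
  case False
  then show ?thesis using h by (simp add: Bp_free)
next
  case True
  define F where "F = sqrf h"
  have F0: "F \<noteq> 0" using h by (simp add: F_def sqrf_nonzero)
  have yF: "y \<in> vars F" using True h by (simp add: F_def vars_sqrf)
  define J where "J = {u * F + v * deriv_in y F | u v. True}"
  have "\<exists>a\<in>J. \<not> \<pi> dvd a" if \<pi>: "Factorial_Ring.irreducible \<pi>" "y \<in> vars \<pi>" for \<pi>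
  proof (rule ccontr)
    assume *: "\<not> (\<exists>a\<in>J. \<not> \<pi> dvd a)"
    have "F \<in> J" unfolding J_def by (force intro: exI[of _ 1] exI[of _ 0])
    moreover have "deriv_in y F \<in> J" unfolding J_def by (force intro: exI[of _ 1] exI[of _ 0])
    ultimately have dvd: "\<pi> dvd F" "\<pi> dvd deriv_in y F" using * by auto
    have F: "F = \<Prod>(fac h)" using True sqrf_eq[of h] by (auto simp: F_def)
    then obtain p where p: "p \<in> fac h" "\<pi> dvd p" using irreducible_dvd_prod[OF \<pi>(1), of "\<lambda>p. p"] dvd by auto
    have irr: "Factorial_Ring.irreducible p" using p by (simp add: fac_def)
    have p0: "p \<noteq> 0" using irr by (auto simp: Factorial_Ring.irreducible_def)
    have "p dvd \<pi>" using irreducible_dvd_imp_dvd[OF \<pi>(1) irr p(2)] .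
    then have "p dvd deriv_in y F" using dvd(2) by (rule dvd_trans)
    have yp: "y \<in> vars p" using vars_dvd[OF p(2) p0] \<pi> by auto
    \<comment> \<open>By the product rule \<open>p\<close> divides \<open>G * deriv_in y p\<close>.
      It does not divide \<open>G\<close>, whose factors are not associated to it, nor the
      derivative, which is nonzero and of smaller degree in \<open>y\<close>.\<close>
    define G where "G = \<Prod>(fac h - {p})"
    have FG: "F = p * G" using prod.remove[OF finite_fac[OF h] p(1), of "\<lambda>p. p"] by (simp add: F G_def)
    have "to_upoly y (deriv_in y F) = to_upoly y (p * deriv_in y G + G * deriv_in y p)"
      by (simp add: to_upoly_deriv_in FG to_upoly_add to_upoly_mult pderiv_mult)
    then have "deriv_in y F = p * deriv_in y G + G * deriv_in y p" by (metis poly_to_upoly)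
    then have "p dvd G * deriv_in y p" using \<open>p dvd deriv_in y F\<close> by (simp add: dvd_add_right_iff)
    then consider "p dvd G" | "p dvd deriv_in y p" using irreducible_dvd_mult[OF irr] by blast
    then show False
    proof cases
      case 1
      then show False using fac_dvd_prod[OF p(1), of "fac h - {p}"] by (auto simp: G_def)
    next
      case 2
      have "deriv_in y p \<noteq> 0"
      proof
        assume "deriv_in y p = 0"
        then have "pderiv (to_upoly y p) = 0" using to_upoly_deriv_in[of y p] by simp
        then have "dg y p = 0" by (simp add: pderiv_eq_0_iff dg_def)
        then show False using yp by (simp add: dg_eq_0_iff)
      qed
      with 2 obtain k where k: "deriv_in y p = p * k" "k \<noteq> 0" by (auto elim: dvdE)
      then have "dg y (deriv_in y p) = dg y p + dg y k" using dg_mult[OF p0] by simp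
      moreover have "dg y (deriv_in y p) = dg y p - 1" by (simp add: dg_def to_upoly_deriv_in degree_pderiv)
      ultimately show False using yp by (simp flip: dg_pos_iff)
    qed
  qed
  moreover have "F \<in> J" unfolding J_def by (force intro: exI[of _ 1] exI[of _ 0])
  moreover have "a + b \<in> J" if ab: "a \<in> J" "b \<in> J" for a b
  proof -
    obtain u v u' v' where "a = u * F + v * deriv_in y F" "b = u' * F + v' * deriv_in y F" using ab by (auto simp: J_def)
    then have "a + b = (u + u') * F + (v + v') * deriv_in y F" by (simp add: algebra_simps)
    then show ?thesis by (auto simp: J_def)
  qed
  moreover have "r * a \<in> J" if a: "a \<in> J" for a r
  proof -
    obtain u v where "a = u * F + v * deriv_in y F" using a by (auto simp: J_def)
    then have "r * a = (r * u) * F + (r * v) * deriv_in y F" by (simp add: algebra_simps)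
    then show ?thesis by (auto simp: J_def)
  qed
  ultimately obtain R where R: "R \<in> J" "R \<noteq> 0" "y \<notin> vars R"
    using F0 by (elim elimination[of F J y, rotated -1]) auto
  then obtain u v where uv: "R = u * F + v * deriv_in y F" by (auto simp: J_def)
  obtain x where x: "meval x (R * lead_coeff (to_upoly y F)) \<noteq> 0"
    using nonvanishing_point[of "R * lead_coeff (to_upoly y F)"] R F0 by auto
  then have lc: "meval x (lead_coeff (to_upoly y F)) \<noteq> 0" by simp
  let ?m = "map_poly (meval x)"
  have "?m (to_upoly y R) = ?m (to_upoly y u) * ?m (to_upoly y F) + ?m (to_upoly y v) * pderiv (?m (to_upoly y F))"
    by (simp add: uv to_upoly_add to_upoly_mult to_upoly_deriv_in meval_poly.hom_add meval_poly.hom_mult map_poly_meval_pderiv)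
  moreover have "?m (to_upoly y R) = [:meval x R:]" using R by (simp add: to_upoly_free map_poly_pCons)
  ultimately have g: "gcd (?m (to_upoly y F)) (pderiv (?m (to_upoly y F))) dvd [:meval x R:]" by simp
  have "Polynomial.degree (gcd (?m (to_upoly y F)) (pderiv (?m (to_upoly y F)))) \<le> Polynomial.degree [:meval x R:]"
    using x by (intro dvd_imp_degree_le g) auto
  then have "resultant (?m (to_upoly y F)) (pderiv (?m (to_upoly y F))) \<noteq> 0" by (simp add: resultant_0_gcd)
  then have "meval x (resultant (to_upoly y F) (pderiv (to_upoly y F))) \<noteq> 0"
    by (simp add: resultant_pderiv_specialize[OF lc])
  then show ?thesis using True by (auto simp: Bp_eq F_def)
qed


subsection \<open>Boxes and components\<close>

definition box_of :: "(nat \<Rightarrow> real set) \<Rightarrow> (nat \<Rightarrow> real) set" where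
  "box_of I = {x. \<forall>i. x i \<in> I i}"

lemma box_of_PiE: "box_of I = PiE UNIV I"
  by (auto simp: box_of_def PiE_def)

lemma connected_box_of: "(\<And>i. connected (I i)) \<Longrightarrow> connected (box_of I)"
  unfolding box_of_PiE connectedin_iff_connected[symmetric] euclidean_product_topology[symmetric]
  by (simp add: connectedin_PiE)

text \<open>Boxes with connected sides form a basis of the topology, so the space of sequences is
  locally connected, and single coordinates can be moved freely inside a box.\<close>

lemma box_nbhd:
  assumes "open W" "a \<in> W"
  obtains I where "\<And>i. open (I i)" "\<And>i. connected (I i)" "open (box_of I)" "a \<in> box_of I" "box_of I \<subseteq> W"
proof -
  have "openin (product_topology (\<lambda>i. euclidean) UNIV) W"
    using assms by (simp add: euclidean_product_topology)
  then obtain V where V: "finite {i. V i \<noteq> UNIV}" "\<And>i. open (V i)" "a \<in> PiE UNIV V" "PiE UNIV V \<subseteq> W"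
    using assms unfolding openin_product_topology_alt by auto
  \<comment> \<open>Sides equal to \<open>UNIV\<close> are kept, since a box with infinitely many
    proper sides need not be open.\<close>
  have "\<exists>J. open J \<and> connected J \<and> a i \<in> J \<and> J \<subseteq> V i \<and> (V i = UNIV \<longrightarrow> J = UNIV)" for i
  proof (cases "V i = UNIV")
    case False
    have "a i \<in> V i" using V by (auto simp: PiE_def)
    then obtain e where "e > 0" "ball (a i) e \<subseteq> V i" using V(2) open_contains_ball by blast
    then show ?thesis using False by (intro exI[of _ "ball (a i) e"]) (auto intro: convex_connected)
  qed auto
  then obtain J where J: "\<And>i. open (J i)" "\<And>i. connected (J i)" "\<And>i. a i \<in> J i" "\<And>i. J i \<subseteq> V i"
      "\<And>i. V i = UNIV \<Longrightarrow> J i = UNIV" by metis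
  show ?thesis
  proof (rule that[OF J(1,2)])
    have "finite {i. J i \<noteq> UNIV}" by (rule finite_subset[OF _ V(1)]) (use J(5) in auto)
    then show "open (box_of J)" unfolding box_of_PiE by (intro open_PiE J(1))
    show "a \<in> box_of J" using J(3) by (simp add: box_of_def)
    show "box_of J \<subseteq> W" using V(4) J(4) by (fastforce simp: box_of_def PiE_def)
  qed
qed

lemma open_component:
  fixes W :: "(nat \<Rightarrow> real) set"
  assumes "open W"
  shows "open (connected_component_set W x)"
proof (subst open_subopen, intro ballI)
  fix y assume y: "y \<in> connected_component_set W x"
  then have "y \<in> W" using connected_component_in by fastforce
  then obtain I where I: "\<And>i. connected (I i)" "open (box_of I)" "y \<in> box_of I" "box_of I \<subseteq> W"
    using box_nbhd[OF assms] by metis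
  then have "box_of I \<subseteq> connected_component_set W y"
    by (intro connected_component_maximal connected_box_of)
  then show "\<exists>T. open T \<and> y \<in> T \<and> T \<subseteq> connected_component_set W x"
    using I y connected_component_eq[of y W x] by blast
qed

definition nonvan :: "zpoly \<Rightarrow> (nat \<Rightarrow> real) set" where
  "nonvan p = {x. meval x p \<noteq> 0}"

lemma open_nonvan: "open (nonvan p)"
  unfolding nonvan_def by (intro open_Collect_neq continuous_intros)

text \<open>The coordinates outside \<open>vars h\<close> range over a connected box on which
  \<open>h\<close> is constant. Hence components are cylinders over the variables of
  \<open>h\<close>.\<close>

lemma component_agree:
  assumes "x \<in> nonvan h" "\<And>i. i \<in> vars h \<Longrightarrow> x i = y i"
  shows "connected_component (nonvan h) x y"
proof (rule connected_componentI)
  let ?I = "\<lambda>i. if i \<in> vars h then {x i} else UNIV"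
  show "connected (box_of ?I)" by (rule connected_box_of) auto
  show "box_of ?I \<subseteq> nonvan h"
  proof
    fix w assume "w \<in> box_of ?I"
    then have "meval w h = meval x h" by (intro meval_cong) (auto simp: box_of_def split: if_splits)
    then show "w \<in> nonvan h" using assms by (simp add: nonvan_def)
  qed
  show "x \<in> box_of ?I" "y \<in> box_of ?I" using assms by (auto simp: box_of_def)
qed

subsection \<open>Sets of codimension two do not disconnect\<close>

text \<open>If R i does not depend on the i-th variable and vanishes on Z, then a line in direction i
  through a point where R i does not vanish misses Z. From a generic point of one part of a
  separation we can therefore change one coordinate after the other and reach the other part.\<close>

lemma connected_Diff:
  fixes U Z :: "(nat \<Rightarrow> real) set"
  assumes U: "open U" "connected U" and Z: "closed Z" and I: "finite I"
    and R: "\<And>i. i \<in> I \<Longrightarrow> R i \<noteq> 0" "\<And>i. i \<in> I \<Longrightarrow> i \<notin> vars (R i)" "\<And>i x. i \<in> I \<Longrightarrow> x \<in> Z \<Longrightarrow> meval x (R i) = 0"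
    and inv: "\<And>x y. (\<And>i. i \<in> I \<Longrightarrow> x i = y i) \<Longrightarrow> x \<in> Z \<Longrightarrow> y \<in> Z"
    and q: "q \<noteq> 0" "\<And>x. x \<in> Z \<Longrightarrow> meval x q = 0"
  shows "connected (U - Z)"
proof (rule ccontr)
  assume "\<not> connected (U - Z)"
  then obtain A0 B0 where AB0: "open A0" "open B0" "U - Z \<subseteq> A0 \<union> B0" "A0 \<inter> B0 \<inter> (U - Z) = {}"
    "A0 \<inter> (U - Z) \<noteq> {}" "B0 \<inter> (U - Z) \<noteq> {}" unfolding connected_def by metis
  define A B where "A = A0 \<inter> (U - Z)" and "B = B0 \<inter> (U - Z)"
  have AB: "open A" "open B" "A \<inter> B = {}" "A \<union> B = U - Z" "A \<noteq> {}" "B \<noteq> {}"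
    using AB0 U Z by (auto simp: A_def B_def open_Diff)
  have stay: "x' \<in> A" if "connected L" "L \<subseteq> U - Z" "x \<in> L" "x \<in> A" "x' \<in> L" for L x x'
  proof (rule ccontr)
    assume "x' \<notin> A"
    then have "x' \<in> B" using that AB by auto
    then have "A \<inter> L = {} \<or> B \<inter> L = {}" using connectedD[OF that(1) AB(1,2)] AB that by auto
    then show False using that \<open>x' \<in> B\<close> by auto
  qed
  \<comment> \<open>As \<open>q\<close> vanishes on \<open>Z\<close>, the set \<open>Z\<close> has
    empty interior. Connectedness of \<open>U\<close> then provides a point in both closures, near
    which \<open>A\<close> and \<open>B\<close> come together in one box.\<close>
  have "U \<subseteq> closure A \<union> closure B"
  proof
    fix x assume x: "x \<in> U"
    show "x \<in> closure A \<union> closure B"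
    proof (rule ccontr)
      assume "x \<notin> closure A \<union> closure B"
      then have "x \<in> U - closure A - closure B" using x by auto
      then obtain y where "y \<in> U - closure A - closure B" "meval y q \<noteq> 0"
        using nonvanishing_dense[OF q(1), of "U - closure A - closure B" x] U by (auto simp: open_Diff)
      then show False using AB q(2) closure_subset by blast
    qed
  qed
  moreover have "closure A \<inter> U \<noteq> {}" "closure B \<inter> U \<noteq> {}" using AB closure_subset by blast+
  ultimately have "closure A \<inter> closure B \<inter> U \<noteq> {}"
    using connected_closedD[OF U(2), of "closure A" "closure B"] by auto
  then obtain x where x: "x \<in> U" "x \<in> closure A" "x \<in> closure B" by blast
  obtain N where N: "\<And>i. open (N i)" "\<And>i. connected (N i)" "open (box_of N)" "x \<in> box_of N" "box_of N \<subseteq> U"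
    using box_nbhd[OF U(1) x(1)] by metis
  have "box_of N \<inter> A \<noteq> {}" "box_of N \<inter> B \<noteq> {}" using N x open_Int_closure_eq_empty by blast+
  then obtain b where b: "b \<in> box_of N \<inter> B" by auto
  \<comment> \<open>\<open>T\<close> is the target: a point of \<open>A\<close> is moved until all
    its coordinates lie in the sides of \<open>T\<close>, which puts it into
    \<open>B\<close>.\<close>
  obtain T where T: "\<And>i. open (T i)" "\<And>i. connected (T i)" "open (box_of T)" "b \<in> box_of T" "box_of T \<subseteq> box_of N \<inter> B"
    using box_nbhd[OF open_Int[OF N(3) AB(2)] b] by metis
  have bT: "b i \<in> T i" for i using T by (auto simp: box_of_def)
  have "\<exists>x\<in>A \<inter> box_of N. \<forall>i\<in>J. x i \<in> T i" if "J \<subseteq> I" for J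
    using finite_subset[OF that I] that
  proof (induction J rule: finite_induct)
    case empty
    then show ?case using \<open>box_of N \<inter> A \<noteq> {}\<close> by auto
  next
    case (insert i J)
    let ?W = "A \<inter> box_of N \<inter> (\<Inter>j\<in>J. {x. x j \<in> T j})"
    obtain x0 where "x0 \<in> ?W" using insert by auto
    moreover have "open {x :: nat \<Rightarrow> real. x j \<in> T j}" for j
      using open_vimage[OF T(1)[of j] continuous_on_product_coordinates[of j]] by (simp add: vimage_def)
    then have "open ?W" using insert N AB by (intro open_Int open_INT) auto
    ultimately obtain x where x: "x \<in> ?W" "meval x (R i) \<noteq> 0"
      using nonvanishing_dense[of "R i" ?W x0] R(1) insert.prems by auto
    define L where "L = (\<lambda>t. x(i := t)) ` N i"
    have "connected L" unfolding L_def by (intro connected_continuous_image N continuous_on_upd)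
    moreover have "L \<subseteq> U - Z"
    proof
      fix w assume "w \<in> L"
      then obtain t where t: "w = x(i := t)" "t \<in> N i" by (auto simp: L_def)
      then have "w \<in> box_of N" using x by (auto simp: box_of_def)
      moreover have "meval w (R i) = meval x (R i)"
        using R(2)[of i] insert.prems t by (intro meval_cong) auto
      then have "w \<notin> Z" using R(3)[of i w] insert.prems x by auto
      ultimately show "w \<in> U - Z" using N by auto
    qed
    moreover have xL: "x \<in> L" unfolding L_def using x by (intro image_eqI[of _ _ "x i"]) (auto simp: box_of_def)
    moreover have "b i \<in> N i" using b by (auto simp: box_of_def)
    then have "x(i := b i) \<in> L" by (auto simp: L_def)
    ultimately have "x(i := b i) \<in> A" using stay[of L x] x by auto
    moreover have "x(i := b i) \<in> box_of N" using x \<open>b i \<in> N i\<close> by (auto simp: box_of_def)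
    ultimately show ?case using x bT by (intro bexI[of _ "x(i := b i)"]) auto
  qed
  then obtain x where x: "x \<in> A" "x \<in> box_of N" "\<And>i. i \<in> I \<Longrightarrow> x i \<in> T i" by blast
  \<comment> \<open>The infinitely many coordinates outside \<open>I\<close> are changed all at
    once; by \<open>inv\<close> they do not affect membership in \<open>Z\<close>.\<close>
  define x' where "x' i = (if i \<in> I then x i else b i)" for i
  have "x' \<in> box_of T" using x bT by (auto simp: x'_def box_of_def)
  then have x'B: "x' \<in> B" "x' \<in> box_of N" using T by auto
  let ?L = "box_of (\<lambda>i. if i \<in> I then {x i} else N i)"
  have "connected ?L" using N(2) by (intro connected_box_of) auto
  moreover have "?L \<subseteq> U - Z"
  proof
    fix w assume w: "w \<in> ?L"
    have wi: "w i \<in> (if i \<in> I then {x i} else N i)" for i using w by (simp add: box_of_def)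
    have "w i \<in> N i" for i using wi[of i] x(2) by (auto simp: box_of_def split: if_splits)
    then have "w \<in> box_of N" by (simp add: box_of_def)
    moreover have "w i = x i" if "i \<in> I" for i using wi[of i] that by simp
    then have "w \<notin> Z" using inv[of w x] x AB by auto
    ultimately show "w \<in> U - Z" using N by auto
  qed
  moreover have "b i \<in> N i" for i using b by (simp add: box_of_def)
  then have "x \<in> ?L" "x' \<in> ?L" using x by (auto simp: box_of_def x'_def)
  ultimately have "x' \<in> A" using stay[of ?L x x'] x by auto
  then show False using x'B AB by auto
qed

subsection \<open>Local delineability\<close>

lemma product_nbhd:
  fixes \<phi> :: "(nat \<Rightarrow> real) \<Rightarrow> real \<Rightarrow> real"
  assumes "continuous_on UNIV (\<lambda>p. \<phi> (fst p) (snd p))" "\<phi> \<alpha> t \<noteq> 0"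
  obtains B e where "open B" "\<alpha> \<in> B" "e > 0" "\<And>\<beta> u. \<beta> \<in> B \<Longrightarrow> \<bar>u - t\<bar> < e \<Longrightarrow> \<phi> \<beta> u \<noteq> 0"
proof -
  have "open {p. \<phi> (fst p) (snd p) \<noteq> 0}" using assms(1) by (intro open_Collect_neq continuous_intros)
  moreover have "(\<alpha>, t) \<in> {p. \<phi> (fst p) (snd p) \<noteq> 0}" using assms(2) by simp
  ultimately obtain B C where BC: "open B" "open C" "(\<alpha>, t) \<in> B \<times> C" "B \<times> C \<subseteq> {p. \<phi> (fst p) (snd p) \<noteq> 0}"
    by (rule open_prod_elim)
  obtain e where e: "e > 0" "ball t e \<subseteq> C" using BC open_contains_ball by (metis mem_Sigma_iff)
  show ?thesis
  proof (rule that[of B e])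
    fix \<beta> u assume "\<beta> \<in> B" "\<bar>u - t\<bar> < e"
    then have "(\<beta>, u) \<in> B \<times> C" using e by (auto simp: dist_real_def abs_minus_commute)
    then show "\<phi> \<beta> u \<noteq> 0" using BC by auto
  qed (use BC e in auto)
qed

lemma continuous_on_upd2:
  "continuous_on UNIV (\<lambda>p :: (nat \<Rightarrow> real) \<times> real. (fst p)(z := snd p))"
proof (rule continuous_on_coordinatewise_then_product)
  fix i show "continuous_on UNIV (\<lambda>p :: (nat \<Rightarrow> real) \<times> real. ((fst p)(z := snd p)) i)"
  proof (cases "i = z")
    case True
    then show ?thesis by (simp add: continuous_on_snd)
  next
    case False
    then show ?thesis
      using continuous_on_product_then_coordinatewise[OF continuous_on_fst[OF continuous_on_id], of UNIV i] by simp
  qed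
qed

lemma continuous_on_meval_upd2:
  "continuous_on UNIV (\<lambda>p :: (nat \<Rightarrow> real) \<times> real. meval ((fst p)(z := snd p)) q)"
  by (rule continuous_on_compose2[OF continuous_on_meval continuous_on_upd2]) auto

text \<open>The reciprocal polynomial controls the roots near infinity.\<close>

lemma bounded_roots:
  assumes "meval \<alpha> (lead_coeff (to_upoly z F)) \<noteq> 0"
  obtains B M where "open B" "\<alpha> \<in> B" "\<And>\<beta> u. \<beta> \<in> B \<Longrightarrow> \<bar>u\<bar> > M \<Longrightarrow> meval (\<beta>(z := u)) F \<noteq> 0"
proof -
  define m where "m = dg z F"
  define c where "c i = Polynomial.coeff (to_upoly z F) i" for i
  define \<phi> where "\<phi> \<beta> u = (\<Sum>i\<le>m. meval \<beta> (c i) * u ^ (m - i))" for \<beta> u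
  \<comment> \<open>The exponent \<open>m - i\<close> is 0 only for \<open>i = m\<close>, so at 0
    the reciprocal polynomial takes the value of the leading coefficient.\<close>
  have "\<phi> \<alpha> 0 = (\<Sum>i\<le>m. if i = m then meval \<alpha> (c m) else 0)"
    unfolding \<phi>_def by (intro sum.cong) auto
  also have "\<dots> \<noteq> 0" using assms by (simp add: c_def m_def dg_def)
  finally have 0: "\<phi> \<alpha> 0 \<noteq> 0" .
  have cm: "continuous_on UNIV (\<lambda>p :: (nat \<Rightarrow> real) \<times> real. meval (fst p) q)" for q
    by (rule continuous_on_compose2[OF continuous_on_meval continuous_on_fst[OF continuous_on_id]]) auto
  have "continuous_on UNIV (\<lambda>p. \<phi> (fst p) (snd p))"
    unfolding \<phi>_def by (intro continuous_intros cm)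
  then obtain B e where B: "open B" "\<alpha> \<in> B" "e > 0" "\<And>\<beta> u. \<beta> \<in> B \<Longrightarrow> \<bar>u - 0\<bar> < e \<Longrightarrow> \<phi> \<beta> u \<noteq> 0"
    by (rule product_nbhd[where \<phi> = \<phi>, OF _ 0]) auto
  show ?thesis
  \<comment> \<open>Beyond the bound \<open>1 / e\<close> the reciprocal \<open>1 / u\<close> is
    within \<open>e\<close> of 0, where \<open>\<phi>\<close> does not vanish.\<close>
  proof (rule that[of B "1 / e"])
    fix \<beta> u assume \<beta>: "\<beta> \<in> B" and u: "\<bar>u\<bar> > 1 / e"
    have "1 / e > 0" using B(3) by simp
    then have "\<bar>u\<bar> > 0" using u by linarith
    then have u0: "u \<noteq> 0" by auto
    have "\<bar>1 / u\<bar> < e" using u B(3) u0 by (simp add: field_simps)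
    then have "\<phi> \<beta> (1 / u) \<noteq> 0" using B(4)[OF \<beta>] by simp
    moreover have "meval (\<beta>(z := u)) F = u ^ m * \<phi> \<beta> (1 / u)"
    proof -
      have "meval (\<beta>(z := u)) F = (\<Sum>i\<le>m. meval \<beta> (c i) * u ^ i)"
        unfolding m_def c_def by (rule meval_upd_sum)
      also have "\<dots> = (\<Sum>i\<le>m. u ^ m * (meval \<beta> (c i) * (1 / u) ^ (m - i)))"
        using u0 by (intro sum.cong) (auto simp: power_diff power_one_over field_simps)
      finally show ?thesis by (simp add: \<phi>_def sum_distrib_left)
    qed
    ultimately show "meval (\<beta>(z := u)) F \<noteq> 0" using u0 by simp
  qed (use B in auto)
qed


lemma vertical_component:
  assumes "\<And>w. w \<in> closed_segment u u' \<Longrightarrow> meval (\<beta>(z := w)) h \<noteq> 0"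
  shows "connected_component (nonvan h) (\<beta>(z := u)) (\<beta>(z := u'))"
proof (rule connected_componentI)
  show "connected ((\<lambda>w. \<beta>(z := w)) ` closed_segment u u')"
    by (intro connected_continuous_image continuous_on_upd connected_segment)
qed (use assms in \<open>auto simp: nonvan_def\<close>)

lemma horizontal_component:
  assumes "connected B" "\<beta> \<in> B" "\<beta>' \<in> B" "\<And>\<gamma>. \<gamma> \<in> B \<Longrightarrow> meval (\<gamma>(z := u)) h \<noteq> 0"
  shows "connected_component (nonvan h) (\<beta>(z := u)) (\<beta>'(z := u))"
proof (rule connected_componentI)
  have "continuous_on UNIV (\<lambda>\<gamma> :: nat \<Rightarrow> real. \<gamma>(z := u))"
    by (rule continuous_on_compose2[OF continuous_on_upd2[of z], of UNIV "\<lambda>\<gamma>. (\<gamma>, u)", simplified])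
      (intro continuous_intros)
  then show "connected ((\<lambda>\<gamma>. \<gamma>(z := u)) ` B)"
    by (intro connected_continuous_image assms) (auto intro: continuous_on_subset)
qed (use assms in \<open>auto simp: nonvan_def\<close>)

text \<open>A point of the fiber over \<beta> can move away from a simple root until it reaches an end
  point of the interval, where no root occurs nearby; there it can move to all fibers close by.\<close>

lemma escape_simple_root:
  assumes "meval (\<alpha>(z := t)) F \<noteq> 0 \<or> meval (\<alpha>(z := t)) (deriv_in z F) \<noteq> 0"
  shows "\<exists>B a b. open B \<and> \<alpha> \<in> B \<and> a < t \<and> t < b \<and>
    (\<forall>\<beta>\<in>B. \<forall>u\<in>{a..b}. meval (\<beta>(z := u)) F \<noteq> 0 \<longrightarrow>
      (\<exists>u'. (\<forall>w\<in>closed_segment u u'. meval (\<beta>(z := w)) F \<noteq> 0) \<and> (\<forall>\<gamma>\<in>B. meval (\<gamma>(z := u')) F \<noteq> 0)))"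
proof (cases "meval (\<alpha>(z := t)) F = 0")
  case False
  obtain B e where B: "open B" "\<alpha> \<in> B" "e > 0"
      "\<And>\<beta> u. \<beta> \<in> B \<Longrightarrow> \<bar>u - t\<bar> < e \<Longrightarrow> meval (\<beta>(z := u)) F \<noteq> 0"
    by (rule product_nbhd[where \<phi> = "\<lambda>\<beta> u. meval (\<beta>(z := u)) F", OF continuous_on_meval_upd2 False]) auto
  have "\<exists>u'. (\<forall>w\<in>closed_segment u u'. meval (\<beta>(z := w)) F \<noteq> 0) \<and> (\<forall>\<gamma>\<in>B. meval (\<gamma>(z := u')) F \<noteq> 0)"
    if "\<beta> \<in> B" "u \<in> {t - e / 2..t + e / 2}" for \<beta> u
  proof -
    have "\<bar>u - t\<bar> < e" using that B(3) by auto
    then show ?thesis using that B(4) by (intro exI[of _ u]) auto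
  qed
  then show ?thesis using B(1-3)
    by (intro exI[of _ B] exI[of _ "t - e / 2"] exI[of _ "t + e / 2"]) auto
next
  case True
  then have "meval (\<alpha>(z := t)) (deriv_in z F) \<noteq> 0" using assms by simp
  then obtain B e where B: "open B" "\<alpha> \<in> B" "e > 0"
      "\<And>\<beta> u. \<beta> \<in> B \<Longrightarrow> \<bar>u - t\<bar> < e \<Longrightarrow> meval (\<beta>(z := u)) (deriv_in z F) \<noteq> 0"
    using product_nbhd[where \<phi> = "\<lambda>\<beta> u. meval (\<beta>(z := u)) (deriv_in z F)", OF continuous_on_meval_upd2, of \<alpha> t] by metis
  \<comment> \<open>Half of \<open>e\<close> keeps the closed interval inside the region where the
    derivative does not vanish; by the mean value theorem each fiber then has at most one root in
    it.\<close>
  define a b where "a = t - e / 2" and "b = t + e / 2"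
  have ab: "a < t" "t < b" using B by (auto simp: a_def b_def)
  have rolle: "r = s" if "\<beta> \<in> B" "r \<in> {a..b}" "s \<in> {a..b}" "meval (\<beta>(z := r)) F = 0" "meval (\<beta>(z := s)) F = 0" for \<beta> r s
  proof -
    let ?p = "map_poly (meval \<beta>) (to_upoly z F)"
    have no: False if rs: "r \<in> {a..b}" "s \<in> {a..b}" "poly ?p r = 0" "poly ?p s = 0" "r < s" for r s
    proof -
      obtain w where w: "r < w" "w < s" "poly ?p s - poly ?p r = (s - r) * poly (pderiv ?p) w"
        using poly_MVT[OF rs(5), of ?p] by auto
      then have "poly (pderiv ?p) w = 0" using rs by simp
      then have "meval (\<beta>(z := w)) (deriv_in z F) = 0"
        by (simp add: meval_upd to_upoly_deriv_in map_poly_meval_pderiv)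
      moreover have "\<bar>w - t\<bar> < e" using w rs B(3) by (auto simp: a_def b_def)
      ultimately show False using B(4) \<open>\<beta> \<in> B\<close> by blast
    qed
    then show ?thesis using that by (metis linorder_neqE_linordered_idom meval_upd)
  qed
  \<comment> \<open>The smaller neighborhood keeps both end points free of roots in all its fibers.
    It still contains \<open>\<alpha>\<close>, because \<open>t\<close> is the only root of that
    fiber in the interval.\<close>
  define B' where "B' = B \<inter> {\<beta>. meval (\<beta>(z := a)) F \<noteq> 0} \<inter> {\<beta>. meval (\<beta>(z := b)) F \<noteq> 0}"
  have "continuous_on UNIV (\<lambda>\<beta>. meval (\<beta>(z := w)) F)" for w
    by (rule continuous_on_compose2[OF continuous_on_meval_upd2[of z F], of UNIV "\<lambda>\<gamma>. (\<gamma>, w)", simplified])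
      (intro continuous_intros)
  then have "open B'" unfolding B'_def by (intro open_Int B open_Collect_neq continuous_intros)
  moreover have "\<alpha> \<in> B'"
    unfolding B'_def using rolle[OF B(2), of t a] rolle[OF B(2), of t b] True ab B(2) by force
  moreover have "\<exists>u'. (\<forall>w\<in>closed_segment u u'. meval (\<beta>(z := w)) F \<noteq> 0) \<and> (\<forall>\<gamma>\<in>B'. meval (\<gamma>(z := u')) F \<noteq> 0)"
    if \<beta>: "\<beta> \<in> B'" and u: "u \<in> {a..b}" and nz: "meval (\<beta>(z := u)) F \<noteq> 0" for \<beta> u
  proof (cases "\<exists>r\<in>{a..u}. meval (\<beta>(z := r)) F = 0")
    case False
    then show ?thesis using u by (intro exI[of _ a]) (auto simp: B'_def closed_segment_eq_real_ivl)
  next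
    case True
    then obtain r where r: "r \<in> {a..u}" "meval (\<beta>(z := r)) F = 0" by blast
    \<comment> \<open>The single root the fiber can have lies below \<open>u\<close>, so the way up
      to \<open>b\<close> is free.\<close>
    have "meval (\<beta>(z := w)) F \<noteq> 0" if w: "w \<in> {u..b}" for w
    proof
      assume "meval (\<beta>(z := w)) F = 0"
      then have "r = w" using rolle[of \<beta> r w] r u w \<beta> by (auto simp: B'_def)
      then have "w = u" using r w by auto
      then show False using nz \<open>meval (\<beta>(z := w)) F = 0\<close> by simp
    qed
    then show ?thesis using u by (intro exI[of _ b]) (auto simp: B'_def closed_segment_eq_real_ivl)
  qed
  ultimately show ?thesis using ab by blast
qed

text \<open>If \<open>z\<close> occurs in \<open>h\<close>, roots over a neighborhood of
  \<open>\<alpha>\<close> are bounded by some \<open>M\<close>, and by compactness finitely many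
  escape intervals cover \<open>{- M..M}\<close>. Over a box inside the finite intersection of their
  neighborhoods, every point moves vertically to a height free of zeros on the whole box and then
  horizontally. If \<open>z\<close> does not occur, \<open>Bp h z\<close> is \<open>h\<close> itself
  and no vertical move is necessary.\<close>

lemma local_delineability:
  assumes h: "h \<noteq> 0" and nz: "meval \<alpha> (Bp h z) \<noteq> 0"
  shows "\<exists>B. open B \<and> \<alpha> \<in> B \<and> (\<forall>\<beta>\<in>B. \<forall>\<beta>'\<in>B. \<forall>t. meval (\<beta>(z := t)) h \<noteq> 0 \<longrightarrow>
    (\<exists>t'. connected_component (nonvan h) (\<beta>(z := t)) (\<beta>'(z := t'))))"
proof (cases "z \<in> vars h")
  case False
  have "\<alpha> \<in> nonvan h" using nz False by (simp add: Bp_free nonvan_def)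
  then obtain I where I: "\<And>i. connected (I i)" "open (box_of I)" "\<alpha> \<in> box_of I" "box_of I \<subseteq> nonvan h"
    using box_nbhd[OF open_nonvan[of h]] by metis
  have h': "meval (\<gamma>(z := t)) h = meval \<gamma> h" for \<gamma> t using False by (intro meval_cong) auto
  have "connected_component (nonvan h) (\<beta>(z := t)) (\<beta>'(z := t))" if "\<beta> \<in> box_of I" "\<beta>' \<in> box_of I" for \<beta> \<beta>' t
    using I that by (intro horizontal_component[of "box_of I"] connected_box_of) (auto simp: h' nonvan_def)
  then show ?thesis using I by blast
next
  case z: True
  define F where "F = sqrf h"
  have Fh: "meval x F = 0 \<longleftrightarrow> meval x h = 0" for x
    using meval_sqrf_eq_0_iff[OF h] z by (auto simp: F_def)
  note Bp = Bp_nonzero_imp[OF z h nz, folded F_def]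
  obtain B0 M where B0: "open B0" "\<alpha> \<in> B0" "\<And>\<beta> u. \<beta> \<in> B0 \<Longrightarrow> \<bar>u\<bar> > M \<Longrightarrow> meval (\<beta>(z := u)) F \<noteq> 0"
    using bounded_roots[OF Bp(1)] by metis
  have "meval (\<alpha>(z := t)) F \<noteq> 0 \<or> meval (\<alpha>(z := t)) (deriv_in z F) \<noteq> 0" for t
    using Bp(2)[of t] by (auto simp: meval_upd to_upoly_deriv_in map_poly_meval_pderiv)
  from escape_simple_root[OF this]
  obtain B a b where B: "\<And>t. open (B t)" "\<And>t. \<alpha> \<in> B t" "\<And>t. a t < t" "\<And>t. t < b t"
    and esc: "\<And>t \<beta> u. \<beta> \<in> B t \<Longrightarrow> u \<in> {a t..b t} \<Longrightarrow> meval (\<beta>(z := u)) F \<noteq> 0 \<Longrightarrow>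
      \<exists>u'. (\<forall>w\<in>closed_segment u u'. meval (\<beta>(z := w)) F \<noteq> 0) \<and> (\<forall>\<gamma>\<in>B t. meval (\<gamma>(z := u')) F \<noteq> 0)"
    by metis
  have "x \<in> (\<Union>t\<in>UNIV. {a t<..<b t})" for x using B(3,4)[of x] by (intro UN_I[of x]) auto
  then have "{- M..M} \<subseteq> (\<Union>t\<in>UNIV. {a t<..<b t})" by blast
  then obtain T where T: "finite T" "{- M..M} \<subseteq> (\<Union>t\<in>T. {a t<..<b t})"
    using compactE_image[OF compact_Icc, of UNIV "\<lambda>t. {a t<..<b t}" "- M" M] by auto
  have "open (B0 \<inter> (\<Inter>t\<in>T. B t))" "\<alpha> \<in> B0 \<inter> (\<Inter>t\<in>T. B t)" using T B B0 by auto
  then obtain I where I: "\<And>i. connected (I i)" "open (box_of I)" "\<alpha> \<in> box_of I" "box_of I \<subseteq> B0 \<inter> (\<Inter>t\<in>T. B t)"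
    using box_nbhd by metis
  have "\<exists>t'. connected_component (nonvan h) (\<beta>(z := t)) (\<beta>'(z := t'))"
    if \<beta>: "\<beta> \<in> box_of I" "\<beta>' \<in> box_of I" and t: "meval (\<beta>(z := t)) h \<noteq> 0" for \<beta> \<beta>' t
  proof -
    have "\<exists>u'. (\<forall>w\<in>closed_segment t u'. meval (\<beta>(z := w)) F \<noteq> 0) \<and> (\<forall>\<gamma>\<in>box_of I. meval (\<gamma>(z := u')) F \<noteq> 0)"
    proof (cases "\<bar>t\<bar> > M")
      case True
      then show ?thesis using B0 \<beta> I by (intro exI[of _ t]) auto
    next
      case False
      then have "t \<in> {- M..M}" by auto
      then obtain s where s: "s \<in> T" "t \<in> {a s<..<b s}" using T by blast
      then have sub: "box_of I \<subseteq> B s" using I(4) by blast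
      have "t \<in> {a s..b s}" "meval (\<beta>(z := t)) F \<noteq> 0" using s t by (auto simp: Fh)
      then obtain u' where "\<forall>w\<in>closed_segment t u'. meval (\<beta>(z := w)) F \<noteq> 0" "\<forall>\<gamma>\<in>B s. meval (\<gamma>(z := u')) F \<noteq> 0"
        using esc[of \<beta> s t] sub \<beta>(1) by blast
      then show ?thesis using sub by (intro exI[of _ u']) blast
    qed
    then obtain u' where u': "\<And>w. w \<in> closed_segment t u' \<Longrightarrow> meval (\<beta>(z := w)) h \<noteq> 0"
      "\<And>\<gamma>. \<gamma> \<in> box_of I \<Longrightarrow> meval (\<gamma>(z := u')) h \<noteq> 0" by (auto simp: Fh)
    have "connected_component (nonvan h) (\<beta>(z := t)) (\<beta>(z := u'))" using u'(1) by (rule vertical_component)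
    moreover have "connected_component (nonvan h) (\<beta>(z := u')) (\<beta>'(z := u'))"
      by (rule horizontal_component[OF connected_box_of[OF I(1)] \<beta> u'(2)])
    ultimately show ?thesis using connected_component_trans by blast
  qed
  then show ?thesis using I by blast
qed


subsection \<open>The operator Hp\<close>

lemma Hp_eq_mgcd: "Y \<noteq> [] \<Longrightarrow> Hp f Y = mgcd (Hp_at f Y ` set Y)"
  by (cases Y) (simp_all add: Hp_at_def del: remove1.simps list.set)

lemma Hp_nonzero_vars:
  assumes f: "f \<noteq> 0"
  shows "distinct Y \<Longrightarrow> Hp f Y \<noteq> 0 \<and> vars (Hp f Y) \<subseteq> vars f - set Y \<and>
    (\<forall>z\<in>set Y. Hp_at f Y z \<noteq> 0 \<and> vars (Hp_at f Y z) \<subseteq> vars f - set Y)"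
proof (induction "length Y" arbitrary: Y rule: less_induct)
  case less
  have at: "Hp_at f Y z \<noteq> 0 \<and> vars (Hp_at f Y z) \<subseteq> vars f - set Y" if z: "z \<in> set Y" for z
  proof -
    have "length (remove1 z Y) < length Y" using z length_pos_if_in_set[OF z] by (simp add: length_remove1)
    then have IH: "Hp f (remove1 z Y) \<noteq> 0" "vars (Hp f (remove1 z Y)) \<subseteq> vars f - (set Y - {z})"
      using less.hyps[of "remove1 z Y"] less.prems by (auto simp: set_remove1_eq)
    then show ?thesis using Bp_nonzero[OF IH(1)] vars_Bp[OF IH(1), of z] unfolding Hp_at_def by blast
  qed
  show ?case
  proof (cases "Y = []")
    case True
    then show ?thesis using f by simp
  next
    case False
    then obtain z where z: "z \<in> set Y" by (cases Y) auto
    then have zA: "Hp_at f Y z \<in> Hp_at f Y ` set Y" "Hp_at f Y z \<noteq> 0" using at by auto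
    note gcd = mgcd[OF zA, folded Hp_eq_mgcd[OF False, of f]]
    have "vars (Hp f Y) \<subseteq> vars (Hp_at f Y z)" using vars_dvd[OF gcd(1)[OF zA(1)] zA(2)] .
    then show ?thesis using at z gcd(3) by blast
  qed
qed

text \<open>The theorem admits \<open>f = 0\<close>: all projections are then 0, and there are no
  open connected sets on either level.\<close>

lemma Hp_0: "Hp 0 Y = 0"
proof (induction "length Y" arbitrary: Y rule: less_induct)
  case less
  show ?case
  proof (cases "Y = []")
    case False
    have "Hp_at 0 Y z = 0" if z: "z \<in> set Y" for z
    proof -
      have "length (remove1 z Y) < length Y" using z length_pos_if_in_set[OF z] by (simp add: length_remove1)
      then show ?thesis using less.hyps[of "remove1 z Y"] by (simp add: Hp_at_def Bp_free)
    qed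
    then have "Hp_at 0 Y ` set Y = (\<lambda>z. 0) ` set Y" by (intro image_cong) auto
    also have "\<dots> = {0}" using False by (simp add: image_constant_conv)
    finally have "Hp_at 0 Y ` set Y = {0}" .
    then show ?thesis using False by (simp add: Hp_eq_mgcd mgcd_0)
  qed simp
qed

text \<open>The gcd \<open>d\<close> has no zero on \<open>U\<close>, so there the common zeros are
  those of the cofactors \<open>k a\<close>. For each variable, elimination from the cofactors gives
  a polynomial without it that vanishes on these zeros, as \<open>connected_Diff\<close>
  requires.\<close>

lemma connected_Diff_zeros_Hp_at:
  assumes f: "f \<noteq> 0" and Y: "distinct Y" "Y \<noteq> []"
    and U: "open U" "connected U" "U \<subseteq> nonvan (Hp f Y)"
  shows "connected (U - {x. \<forall>z\<in>set Y. meval x (Hp_at f Y z) = 0})"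
proof -
  define d where "d = Hp f Y"
  define A where "A = Hp_at f Y ` set Y"
  note props = Hp_nonzero_vars[OF f Y(1)]
  obtain z0 where z0: "z0 \<in> set Y" using Y by (cases Y) auto
  have a0: "Hp_at f Y z0 \<in> A" "Hp_at f Y z0 \<noteq> 0" using props z0 by (auto simp: A_def)
  have d_eq: "mgcd A = d" using Hp_eq_mgcd[OF Y(2), of f] by (simp add: A_def d_def)
  note gcd = mgcd[OF a0, unfolded d_eq]
  have "\<forall>a\<in>A. \<exists>k. a = d * k" using gcd(1) by (auto elim: dvdE)
  then obtain k where k: "\<And>a. a \<in> A \<Longrightarrow> a = d * k a" by metis
  have k0: "k (Hp_at f Y z0) \<in> k ` A" "k (Hp_at f Y z0) \<noteq> 0" using k[OF a0(1)] a0 by auto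
  \<comment> \<open>If \<open>e\<close> divides all cofactors, then \<open>d * e\<close> divides all
    of \<open>A\<close> and hence \<open>d\<close>, so \<open>e\<close> is a unit.\<close>
  have cop: "e dvd 1" if e: "\<And>b. b \<in> k ` A \<Longrightarrow> e dvd b" for e
  proof -
    have "d * e dvd a" if "a \<in> A" for a
      using e[of "k a"] k[OF that] that by (metis dvd_refl image_eqI mult_dvd_mono)
    then have "d * e dvd d" using gcd(2) by blast
    then obtain c where "d = d * e * c" by (rule dvdE)
    then have "1 = e * c" using gcd(3) by (metis mult.assoc mult.right_neutral mult_cancel_left)
    then show ?thesis by (rule dvdI)
  qed
  have "\<exists>R. R \<noteq> 0 \<and> y \<notin> vars R \<and> (\<forall>x. (\<forall>b\<in>k ` A. meval x b = 0) \<longrightarrow> meval x R = 0)" for y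
    by (rule elimination_zeros[OF k0 cop, of y]) blast+
  then obtain R where R: "\<And>y. R y \<noteq> 0" "\<And>y. y \<notin> vars (R y)"
    "\<And>y x. (\<And>b. b \<in> k ` A \<Longrightarrow> meval x b = 0) \<Longrightarrow> meval x (R y) = 0" by metis
  define Z where "Z = {x. \<forall>b\<in>k ` A. meval x b = 0}"
  have "finite A" by (simp add: A_def)
  have "connected (U - Z)"
  proof (rule connected_Diff[OF U(1,2), where I = "\<Union>(vars ` k ` A)" and R = R and q = "k (Hp_at f Y z0)"])
    have "Z = (\<Inter>b\<in>k ` A. {x. meval x b = 0})" by (auto simp: Z_def)
    then show "closed Z" by (auto intro!: closed_INT closed_Collect_eq continuous_intros)
    show "finite (\<Union>(vars ` k ` A))" using \<open>finite A\<close> by auto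
    show "y \<in> Z" if xy: "\<And>i. i \<in> \<Union>(vars ` k ` A) \<Longrightarrow> x i = y i" "x \<in> Z" for x y
    proof -
      have "meval y b = meval x b" if "b \<in> k ` A" for b
        by (rule meval_cong) (use xy(1) that in fastforce)
      then show ?thesis using xy(2) by (simp add: Z_def)
    qed
    show "meval x (R i) = 0" if "x \<in> Z" for i x
      using that R(3)[where x = x and y = i] unfolding Z_def by blast
    show "meval x (k (Hp_at f Y z0)) = 0" if "x \<in> Z" for x
      using that k0(1) unfolding Z_def by blast
  qed (use R k0 in auto)
  moreover have "U - Z = U - {x. \<forall>z\<in>set Y. meval x (Hp_at f Y z) = 0}"
  proof -
    have "(\<forall>b\<in>k ` A. meval x b = 0) \<longleftrightarrow> (\<forall>z\<in>set Y. meval x (Hp_at f Y z) = 0)" if "x \<in> U" for x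
    proof -
      have "meval x d \<noteq> 0" using that U(3) by (auto simp: d_def nonvan_def)
      then have "meval x a = 0 \<longleftrightarrow> meval x (k a) = 0" if "a \<in> A" for a
        using k[OF that] by (metis meval_mult mult_eq_0_iff)
      then show ?thesis by (simp add: A_def)
    qed
    then show ?thesis by (auto simp: Z_def)
  qed
  ultimately show ?thesis by simp
qed

subsection \<open>Cylinders over components\<close>

text \<open>A set that ignores the coordinates in \<open>P\<close> stands for a set in the space of
  the remaining coordinates, so an open subset of a base space becomes an open saturated
  set.\<close>

definition saturated :: "nat set \<Rightarrow> (nat \<Rightarrow> real) set \<Rightarrow> bool" where
  "saturated P W \<longleftrightarrow> (\<forall>x\<in>W. \<forall>x'. (\<forall>i. i \<notin> P \<longrightarrow> x i = x' i) \<longrightarrow> x' \<in> W)"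

lemma saturatedD: "saturated P W \<Longrightarrow> x \<in> W \<Longrightarrow> (\<And>i. i \<notin> P \<Longrightarrow> x i = x' i) \<Longrightarrow> x' \<in> W"
  by (auto simp: saturated_def)

lemma saturated_Int: "saturated P W \<Longrightarrow> saturated P W' \<Longrightarrow> saturated P (W \<inter> W')"
  unfolding saturated_def by blast

lemma saturated_mono: "saturated P W \<Longrightarrow> P' \<subseteq> P \<Longrightarrow> saturated P' W"
  unfolding saturated_def by blast

lemma saturated_component:
  assumes "vars h \<inter> P = {}"
  shows "saturated P (connected_component_set (nonvan h) x)"
  unfolding saturated_def
proof (intro ballI allI impI)
  fix y y' assume y: "y \<in> connected_component_set (nonvan h) x" and *: "\<forall>i. i \<notin> P \<longrightarrow> y i = y' i"
  then have "y \<in> nonvan h" using connected_component_in by fastforce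
  then have "connected_component (nonvan h) y y'" using * assms by (intro component_agree) auto
  then show "y' \<in> connected_component_set (nonvan h) x" using y connected_component_trans by fastforce
qed

text \<open>Local delineability need not give a saturated neighborhood. It is pulled back along the
  map \<open>\<rho>\<close> that replaces the coordinates in \<open>P\<close> by those of
  \<open>\<alpha>\<close>; apart from \<open>z\<close>, which is overwritten in the fiber anyway,
  \<open>h\<close> does not see them.\<close>

lemma fiber_nbhd:
  assumes h: "h \<noteq> 0" "meval \<alpha> (Bp h z) \<noteq> 0" and P: "z \<in> P" "vars h \<inter> P \<subseteq> {z}"
  obtains B where "open B" "\<alpha> \<in> B" "saturated P B"
    "\<And>\<beta> \<beta>' t. \<beta> \<in> B \<Longrightarrow> \<beta>' \<in> B \<Longrightarrow> meval (\<beta>(z := t)) h \<noteq> 0 \<Longrightarrow>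
      \<exists>t'. connected_component (nonvan h) (\<beta>(z := t)) (\<beta>'(z := t'))"
proof -
  obtain B0 where B0: "open B0" "\<alpha> \<in> B0"
    "\<And>\<beta> \<beta>' t. \<beta> \<in> B0 \<Longrightarrow> \<beta>' \<in> B0 \<Longrightarrow> meval (\<beta>(z := t)) h \<noteq> 0 \<Longrightarrow>
      \<exists>t'. connected_component (nonvan h) (\<beta>(z := t)) (\<beta>'(z := t'))"
    using local_delineability[OF h] by blast
  define \<rho> where "\<rho> x = (\<lambda>i. if i \<in> P then \<alpha> i else x i)" for x :: "nat \<Rightarrow> real"
  have "continuous_on UNIV \<rho>"
    unfolding \<rho>_def
  proof (rule continuous_on_coordinatewise_then_product)
    fix i show "continuous_on UNIV (\<lambda>x :: nat \<Rightarrow> real. if i \<in> P then \<alpha> i else x i)" by (cases "i \<in> P") auto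
  qed
  then have "open (\<rho> -` B0)" by (rule open_vimage[OF B0(1)])
  moreover have "\<rho> \<alpha> = \<alpha>" by (auto simp: \<rho>_def)
  then have "\<alpha> \<in> \<rho> -` B0" using B0 by simp
  moreover have "saturated P (\<rho> -` B0)"
    unfolding saturated_def
  proof (intro ballI allI impI)
    fix x x' assume x: "x \<in> \<rho> -` B0" "\<forall>i. i \<notin> P \<longrightarrow> x i = x' i"
    then have "\<rho> x' = \<rho> x" by (auto simp: \<rho>_def)
    then show "x' \<in> \<rho> -` B0" using x by simp
  qed
  moreover have "\<exists>t'. connected_component (nonvan h) (\<beta>(z := t)) (\<beta>'(z := t'))"
    if b: "\<beta> \<in> \<rho> -` B0" "\<beta>' \<in> \<rho> -` B0" "meval (\<beta>(z := t)) h \<noteq> 0" for \<beta> \<beta>' t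
  proof -
    have agree: "i \<in> vars h \<Longrightarrow> (\<gamma>(z := s)) i = ((\<rho> \<gamma>)(z := s)) i" for \<gamma> s i
      using P by (auto simp: \<rho>_def)
    have 1: "connected_component (nonvan h) (\<beta>(z := t)) ((\<rho> \<beta>)(z := t))"
      using b by (intro component_agree agree) (auto simp: nonvan_def)
    then have "meval ((\<rho> \<beta>)(z := t)) h \<noteq> 0" using connected_component_in by (fastforce simp: nonvan_def)
    then obtain t' where 2: "connected_component (nonvan h) ((\<rho> \<beta>)(z := t)) ((\<rho> \<beta>')(z := t'))"
      using B0(3)[of "\<rho> \<beta>" "\<rho> \<beta>'" t] b by auto
    have "connected_component (nonvan h) ((\<rho> \<beta>')(z := t')) (\<beta>'(z := t'))"
      by (rule component_agree[OF conjunct2[OF connected_component_in[OF 2]] agree[symmetric]])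
    then show ?thesis using 1 2 connected_component_trans by blast
  qed
  ultimately show ?thesis using that[of "\<rho> -` B0"] by presburger
qed

text \<open>The component V need not meet every fiber over U: over some points all the polynomials
  Hp(f, [Y'], z) of the next level may vanish identically. But it is dense over U.\<close>

lemma component_meets_cylinders:
  assumes f: "f \<noteq> 0" and V_def: "V = connected_component_set (nonvan f) v0"
  shows "distinct Y \<Longrightarrow> V \<inter> connected_component_set (nonvan (Hp f Y)) u \<noteq> {} \<Longrightarrow>
    open W \<Longrightarrow> saturated (set Y) W \<Longrightarrow> W \<subseteq> connected_component_set (nonvan (Hp f Y)) u \<Longrightarrow> W \<noteq> {} \<Longrightarrow> V \<inter> W \<noteq> {}"
proof (induction "length Y" arbitrary: Y u W rule: less_induct)
  case less
  define U where "U = connected_component_set (nonvan (Hp f Y)) u"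
  have V: "open V" unfolding V_def by (rule open_component[OF open_nonvan])
  show ?case
  proof (cases "Y = []")
    case True
    then have "V = U" using less.prems(2) unfolding V_def U_def
      by (metis Hp.simps(1) connected_component_nonoverlap)
    then show ?thesis using less.prems unfolding U_def by blast
  next
    case False
    note props = Hp_nonzero_vars[OF f less.prems(1)]
    define Z where "Z = {x. \<forall>z\<in>set Y. meval x (Hp_at f Y z) = 0}"
    obtain z0 where z0: "z0 \<in> set Y" using False by (cases Y) auto
    have U: "open U" "connected U" "U \<subseteq> nonvan (Hp f Y)"
      unfolding U_def by (simp_all add: open_component open_nonvan connected_component_subset)
    have S: "connected (U - Z)"
      unfolding Z_def by (rule connected_Diff_zeros_Hp_at[OF f less.prems(1) False U])
    have generic: "\<exists>x\<in>W. x \<notin> Z" if W: "open W" "W \<noteq> {}" for W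
      using nonvanishing_dense[of "Hp_at f Y z0" W] props z0 W by (fastforce simp: Z_def)
    \<comment> \<open>In terms of the base space, \<open>x\<close> lies in the closure of the
      projection of \<open>V\<close>.\<close>
    define meets where "meets x \<longleftrightarrow> (\<forall>W. open W \<and> saturated (set Y) W \<and> x \<in> W \<longrightarrow> V \<inter> W \<noteq> {})" for x
    have nbhd: "\<exists>B. open B \<and> \<alpha> \<in> B \<and> (\<forall>\<beta>\<in>B. meets \<beta>)" if \<alpha>: "meets \<alpha>" "\<alpha> \<notin> Z" for \<alpha>
    proof -
      obtain z where z: "z \<in> set Y" "meval \<alpha> (Hp_at f Y z) \<noteq> 0" using \<alpha> by (auto simp: Z_def)
      define Y' where "Y' = remove1 z Y"
      define h where "h = Hp f Y'"
      have Y': "distinct Y'" "length Y' < length Y" "set Y' = set Y - {z}"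
        using z(1) less.prems(1) length_pos_if_in_set[OF z(1)] by (auto simp: Y'_def length_remove1 set_remove1_eq)
      have h: "h \<noteq> 0" "vars h \<inter> set Y' = {}" using Hp_nonzero_vars[OF f Y'(1)] by (auto simp: h_def)
      have "meval \<alpha> (Bp h z) \<noteq> 0" using z by (simp add: Hp_at_def h_def Y'_def)
      then obtain B where B: "open B" "\<alpha> \<in> B" "saturated (set Y) B"
        "\<And>\<beta> \<beta>' t. \<beta> \<in> B \<Longrightarrow> \<beta>' \<in> B \<Longrightarrow> meval (\<beta>(z := t)) h \<noteq> 0 \<Longrightarrow>
          \<exists>t'. connected_component (nonvan h) (\<beta>(z := t)) (\<beta>'(z := t'))"
        using fiber_nbhd[OF h(1) _ z(1)] h(2) Y'(3) by (metis Diff_disjoint Int_insert_right_if1 Int_Diff Diff_eq_empty_iff)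
      have "V \<inter> B \<noteq> {}" using \<alpha> B by (auto simp: meets_def)
      then obtain v where v: "v \<in> V" "v \<in> B" "meval v h \<noteq> 0"
        using nonvanishing_dense[OF h(1) open_Int[OF V B(1)]] by blast
      have "meets \<beta>" if \<beta>: "\<beta> \<in> B" for \<beta>
        unfolding meets_def
      proof (intro allI impI, elim conjE)
        fix W assume W: "open W" "saturated (set Y) W" "\<beta> \<in> W"
        obtain t' where t': "connected_component (nonvan h) v (\<beta>(z := t'))"
          using B(4)[OF v(2) \<beta>, of "v z"] v(3) by auto
        let ?U' = "connected_component_set (nonvan h) v"
        \<comment> \<open>The induction hypothesis is used over the component of \<open>v\<close>,
          where \<open>V\<close> has the point \<open>v\<close> itself. By saturation
          \<open>\<beta>(z := t')\<close> stays in \<open>W\<close>, so \<open>W\<close> reaches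
          into that component.\<close>
        have "V \<inter> (W \<inter> ?U') \<noteq> {}"
        proof (rule less.hyps[OF Y'(2,1), of v, folded h_def])
          have "v \<in> ?U'" using v by (simp add: nonvan_def)
          then show "V \<inter> ?U' \<noteq> {}" using v by blast
          show "open (W \<inter> ?U')" by (intro open_Int W open_component open_nonvan)
          show "saturated (set Y') (W \<inter> ?U')"
            by (intro saturated_Int saturated_component h saturated_mono[OF W(2)]) (simp add: Y')
          have "\<beta>(z := t') \<in> W" by (rule saturatedD[OF W(2,3)]) (use z in auto)
          then show "W \<inter> ?U' \<noteq> {}" using t' by blast
        qed auto
        then show "V \<inter> W \<noteq> {}" by blast
      qed
      then show ?thesis using B by blast
    qed
    \<comment> \<open>Points at which \<open>meets\<close> fails always form an open set; by
      \<open>nbhd\<close> those at which it holds are interior away from \<open>Z\<close>. The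
      connected set \<open>U - Z\<close> must lie on one side.\<close>
    define E1 where "E1 = \<Union>{B. open B \<and> (\<forall>\<beta>\<in>B. meets \<beta>)}"
    define E2 where "E2 = \<Union>{W. open W \<and> saturated (set Y) W \<and> V \<inter> W = {}}"
    have "E1 \<inter> (U - Z) = {} \<or> E2 \<inter> (U - Z) = {}"
    proof (rule connectedD[OF S])
      show "open E1" "open E2" by (auto simp: E1_def E2_def)
      show "E1 \<inter> E2 \<inter> (U - Z) = {}" unfolding E1_def E2_def meets_def by blast
      show "U - Z \<subseteq> E1 \<union> E2"
      proof
        fix x assume x: "x \<in> U - Z"
        show "x \<in> E1 \<union> E2"
        proof (cases "meets x")
          case True
          then show ?thesis using nbhd[of x] x unfolding E1_def by blast
        next
          case False
          then show ?thesis unfolding E2_def meets_def by blast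
        qed
      qed
    qed
    moreover have "E1 \<inter> (U - Z) \<noteq> {}"
    proof -
      obtain x where x: "x \<in> V \<inter> U" "x \<notin> Z" using generic[of "V \<inter> U"] V U less.prems(2) by (auto simp: U_def)
      then have "meets x" unfolding meets_def by blast
      then show ?thesis using nbhd[of x] x unfolding E1_def by blast
    qed
    ultimately have "E2 \<inter> (U - Z) = {}" by blast
    \<comment> \<open>If \<open>V\<close> missed \<open>W\<close>, this point of
      \<open>U - Z\<close> would belong to \<open>E2\<close>.\<close>
    moreover obtain x where "x \<in> W" "x \<notin> Z" using generic less.prems by blast
    ultimately have "x \<notin> E2" "x \<in> W" using less.prems(5) unfolding U_def by blast+
    then show ?thesis using less.prems unfolding E2_def by blast
  qed
qed

text \<open>This is one step up in OpenSP. It is not claimed that \<open>V\<close> has a point over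
  \<open>\<beta>\<close>, only that \<open>V\<close> meets the component of the lifted point, which
  is the form that can be iterated.\<close>

lemma component_lift:
  assumes f: "f \<noteq> 0" and Y: "distinct Y" "z \<in> set Y" and \<beta>: "meval \<beta> (Hp f Y) \<noteq> 0" "meval \<beta> (Hp_at f Y z) \<noteq> 0"
    and V: "V = connected_component_set (nonvan f) v0" "V \<inter> connected_component_set (nonvan (Hp f Y)) \<beta> \<noteq> {}"
  shows "\<exists>t. meval (\<beta>(z := t)) (Hp f (remove1 z Y)) \<noteq> 0 \<and>
    V \<inter> connected_component_set (nonvan (Hp f (remove1 z Y))) (\<beta>(z := t)) \<noteq> {}"
proof -
  define h where "h = Hp f (remove1 z Y)"
  have h: "h \<noteq> 0" "vars h \<inter> set Y \<subseteq> {z}"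
    using Hp_nonzero_vars[OF f, of "remove1 z Y"] Y by (auto simp: h_def set_remove1_eq)
  have "meval \<beta> (Bp h z) \<noteq> 0" using \<beta> by (simp add: Hp_at_def h_def)
  then obtain B where B: "open B" "\<beta> \<in> B" "saturated (set Y) B"
    "\<And>\<gamma> \<gamma>' t. \<gamma> \<in> B \<Longrightarrow> \<gamma>' \<in> B \<Longrightarrow> meval (\<gamma>(z := t)) h \<noteq> 0 \<Longrightarrow>
      \<exists>t'. connected_component (nonvan h) (\<gamma>(z := t)) (\<gamma>'(z := t'))"
    using fiber_nbhd[OF h(1) _ Y(2) h(2)] by metis
  let ?U = "connected_component_set (nonvan (Hp f Y)) \<beta>"
  have "V \<inter> (B \<inter> ?U) \<noteq> {}"
  proof (rule component_meets_cylinders[OF f V(1) Y(1) V(2)])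
    show "open (B \<inter> ?U)" by (intro open_Int B open_component open_nonvan)
    show "saturated (set Y) (B \<inter> ?U)"
      using Hp_nonzero_vars[OF f Y(1)] by (intro saturated_Int saturated_component B) auto
    have "\<beta> \<in> ?U" using \<beta> by (simp add: nonvan_def)
    then show "B \<inter> ?U \<noteq> {}" using B by blast
  qed auto
  then obtain v0 where "v0 \<in> V \<inter> B" by blast
  moreover have "open (V \<inter> B)" unfolding V(1) by (intro open_Int B open_component open_nonvan)
  ultimately obtain v where v: "v \<in> V" "v \<in> B" "meval v h \<noteq> 0"
    using nonvanishing_dense[OF h(1)] by blast
  obtain t where t: "connected_component (nonvan h) v (\<beta>(z := t))"
    using B(4)[OF v(2) B(2), of "v z"] v(3) by auto
  then have "v \<in> connected_component_set (nonvan h) (\<beta>(z := t))" by (simp add: connected_component_sym)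
  moreover have "meval (\<beta>(z := t)) h \<noteq> 0" using connected_component_in[OF t] by (simp add: nonvan_def)
  ultimately show ?thesis unfolding h_def[symmetric] using v by blast
qed


subsection \<open>Outputs of OpenSP\<close>

lemma Euclidean_space_top_of_set: "Euclidean_space k = top_of_set (topspace (Euclidean_space k))"
  unfolding topspace_Euclidean_space by (simp add: Euclidean_space_def euclidean_product_topology)

lemma open_conn_sets_top_of_set:
  "open_conn_sets (top_of_set E) h = (\<lambda>x. connected_component_set (E \<inter> {x. h x \<noteq> 0}) x) ` (E \<inter> {x. h x \<noteq> 0})"
proof -
  have "connected_component_of (top_of_set S) = connected_component S" for S :: "'a set"
    by (auto simp: fun_eq_iff connected_component_of_def connected_component_def connectedin_subtopology)
  then show ?thesis
    by (simp add: open_conn_sets_def connected_components_of_def subtopology_subtopology)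
qed

lemma open_conn_sets_Euclidean_space:
  fixes k defines "E \<equiv> topspace (Euclidean_space k)"
  shows "open_conn_sets (Euclidean_space k) (\<lambda>x. meval x p) =
    (\<lambda>x. connected_component_set (E \<inter> nonvan p) x) ` (E \<inter> nonvan p)"
  using open_conn_sets_top_of_set[of E "\<lambda>x. meval x p"] Euclidean_space_top_of_set[of k]
  by (simp add: E_def nonvan_def)

definition trunc :: "nat \<Rightarrow> (nat \<Rightarrow> real) \<Rightarrow> nat \<Rightarrow> real" where
  "trunc k x = (\<lambda>i. if i < k then x i else 0)"

lemma trunc_in_Euclidean_space [simp]: "trunc k x \<in> topspace (Euclidean_space k)"
  by (simp add: topspace_Euclidean_space trunc_def)

lemma trunc_eq: "x \<in> topspace (Euclidean_space k) \<Longrightarrow> trunc k x = x"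
  by (force simp: topspace_Euclidean_space trunc_def)

lemma continuous_on_trunc: "continuous_on A (trunc k)"
  unfolding trunc_def
proof (rule continuous_on_coordinatewise_then_product)
  fix i show "continuous_on A (\<lambda>x :: nat \<Rightarrow> real. if i < k then x i else 0)"
    by (cases "i < k") (auto intro: continuous_on_subset[OF continuous_on_product_coordinates])
qed

lemma meval_trunc: "vars p \<subseteq> {..<k} \<Longrightarrow> meval (trunc k x) p = meval x p"
  by (rule meval_cong) (auto simp: trunc_def)

lemma component_trunc:
  assumes "vars p \<subseteq> {..<k}" "meval x p \<noteq> 0"
  shows "connected_component (nonvan p) x (trunc k x)"
  using assms by (intro component_agree) (auto simp: nonvan_def trunc_def)

text \<open>Truncation is continuous, fixes the points of R^k and preserves the value of
  \<open>p\<close>, so it maps connected sets of sequences off the zeros of \<open>p\<close> to such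
  sets in R^k.\<close>

lemma component_Euclidean_space:
  assumes p: "vars p \<subseteq> {..<k}" and x: "x \<in> topspace (Euclidean_space k)"
  shows "connected_component_set (topspace (Euclidean_space k) \<inter> nonvan p) x =
    topspace (Euclidean_space k) \<inter> connected_component_set (nonvan p) x"
proof (intro subset_antisym subsetI)
  fix y assume "y \<in> connected_component_set (topspace (Euclidean_space k) \<inter> nonvan p) x"
  then show "y \<in> topspace (Euclidean_space k) \<inter> connected_component_set (nonvan p) x"
    using connected_component_in connected_component_of_subset[of _ x y "nonvan p"] by fastforce
next
  fix y assume y: "y \<in> topspace (Euclidean_space k) \<inter> connected_component_set (nonvan p) x"
  then obtain T where T: "connected T" "T \<subseteq> nonvan p" "x \<in> T" "y \<in> T" by (auto simp: connected_component_def)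
  have "connected (trunc k ` T)" by (intro connected_continuous_image continuous_on_trunc T)
  moreover have "trunc k ` T \<subseteq> topspace (Euclidean_space k) \<inter> nonvan p"
    using T by (auto simp: nonvan_def meval_trunc[OF p])
  moreover have "x \<in> trunc k ` T" "y \<in> trunc k ` T"
    using T trunc_eq[OF x] trunc_eq[of y k] y by (metis IntD1 image_eqI)+
  ultimately show "y \<in> connected_component_set (topspace (Euclidean_space k) \<inter> nonvan p) x"
    using connected_componentI by (metis mem_Collect_eq)
qed

lemma open_conn_setsE:
  assumes C: "C \<in> open_conn_sets (Euclidean_space k) (\<lambda>x. meval x p)" and p: "vars p \<subseteq> {..<k}"
  obtains x where "x \<in> topspace (Euclidean_space k)" "meval x p \<noteq> 0"
    "C = topspace (Euclidean_space k) \<inter> connected_component_set (nonvan p) x"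
proof -
  obtain x where x: "x \<in> topspace (Euclidean_space k) \<inter> nonvan p"
      "C = connected_component_set (topspace (Euclidean_space k) \<inter> nonvan p) x"
    using C unfolding open_conn_sets_Euclidean_space by blast
  show ?thesis
    by (rule that[of x]) (use x component_Euclidean_space[OF p, of x] in \<open>auto simp: nonvan_def\<close>)
qed

lemma open_conn_setsI:
  assumes "vars p \<subseteq> {..<k}" "x \<in> topspace (Euclidean_space k)" "meval x p \<noteq> 0"
  shows "topspace (Euclidean_space k) \<inter> connected_component_set (nonvan p) x
    \<in> open_conn_sets (Euclidean_space k) (\<lambda>x. meval x p)"
  unfolding component_Euclidean_space[OF assms(1,2), symmetric]
  using assms unfolding open_conn_sets_Euclidean_space by (auto simp: nonvan_def)

lemma open_sample_real:
  assumes "open_sample_nz euclideanreal \<phi> \<gamma> T" "\<phi> t' \<noteq> 0"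
  obtains t where "t \<in> T" "\<phi> t \<noteq> 0" "\<gamma> t \<noteq> 0" "connected_component {t. \<phi> t \<noteq> 0} t' t"
proof -
  have "connected_component_set {t. \<phi> t \<noteq> 0} t' \<in> open_conn_sets (top_of_set UNIV) \<phi>"
    unfolding open_conn_sets_top_of_set using assms(2) by auto
  then have "T \<inter> connected_component_set {t. \<phi> t \<noteq> 0} t' \<noteq> {}"
    using assms(1) by (simp add: open_sample_nz_def open_sample_def)
  then obtain t where "t \<in> T" "connected_component {t. \<phi> t \<noteq> 0} t' t" by blast
  then show ?thesis using that[of t] assms(1) connected_component_in[of "{t. \<phi> t \<noteq> 0}" t' t]
    by (auto simp: open_sample_nz_def)
qed

section \<open>Levels of the projection lists and lifting of samples\<close>

lemma xvars_Suc: "xvars n (Suc i) = rev [i..<n]"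
  by (simp add: xvars_def)

text \<open>The index \<open>i\<close> belongs to x_(i+1), the last entry of the list, so putting
  back this variable leads from level \<open>i\<close> to level \<open>i + 1\<close>.\<close>

lemma remove1_xvars: "i < n \<Longrightarrow> remove1 i (xvars n (Suc i)) = xvars n (Suc (Suc i))"
  by (simp add: xvars_Suc upt_conv_Cons remove1_append)

lemma nth_rev_upt: "k < b - a \<Longrightarrow> rev [a..<b] ! k = b - Suc k"
  by (simp add: rev_nth)

text \<open>Level \<open>i\<close> has the variables x_1 to x_i, so x_n down to x_(i+1) have been
  eliminated. For \<open>i = n\<close> the list is empty and the entry is \<open>f\<close>.\<close>

lemma Hp_bar_nth:
  assumes "1 \<le> j" "j - 1 \<le> i" "i \<le> n"
  shows "Hp_bar n f j ! (n - i) = Hp f (xvars n (Suc i))"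
proof (cases "i = n")
  case True
  then show ?thesis by (simp add: Hp_bar_def xvars_Suc)
next
  case False
  then obtain k where k: "n - i = Suc k" using assms by (metis Suc_diff_Suc le_neq_implies_less)
  then have "k < Suc n - j" "Suc n - Suc k = Suc i" using assms False by auto
  then show ?thesis unfolding Hp_bar_def k by (simp add: nth_rev_upt del: upt_Suc)
qed

lemma Hp_tilde_nth:
  assumes "1 \<le> j" "j - 1 \<le> i" "i < n"
  shows "Hp_tilde n f j ! (n - i) = Hp_at f (xvars n (Suc i)) i"
proof -
  obtain k where k: "n - i = Suc k" using assms by (metis Suc_diff_Suc)
  then have "k < Suc n - j" "Suc n - Suc k = Suc i" using assms by auto
  then show ?thesis unfolding Hp_tilde_def k by (simp add: nth_rev_upt del: upt_Suc)
qed

lemma Hp_lists_hd_last: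
  assumes "1 \<le> j" "j \<le> n"
  shows "hd (Hp_bar n f j) = f" "last (Hp_bar n f j) = Hp f (xvars n j)"
    "last (Hp_tilde n f j) = Hp_at f (xvars n j) (j - 1)"
  using assms by (auto simp: Hp_bar_def Hp_tilde_def last_map last_rev)

lemma OpenSP_subset:
  assumes "A \<in> OpenSP n l L1 L2 T" "l \<le> n" "T \<subseteq> topspace (Euclidean_space l)"
  shows "A \<subseteq> topspace (Euclidean_space n)"
proof -
  obtain Q where Q: "Q l = T" "Q n = A" and *:
    "\<forall>i\<in>{l<..n}. \<exists>\<tau>. (\<forall>\<alpha> \<in> Q (i - 1). open_sample_nz euclideanreal
           (\<lambda>t. meval (\<alpha>(i - 1 := t)) (L1 ! (n - i)))
           (\<lambda>t. meval (\<alpha>(i - 1 := t)) (L2 ! (n - i))) (\<tau> \<alpha>)) \<and>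
        Q i = (\<Union>\<alpha> \<in> Q (i - 1). (\<lambda>t. \<alpha>(i - 1 := t)) ` \<tau> \<alpha>)"
    using assms(1) unfolding OpenSP_def mem_Collect_eq by (elim exE conjE) (rule that)
  have Q': "\<exists>\<tau>. Q i = (\<Union>\<alpha> \<in> Q (i - 1). (\<lambda>t. \<alpha>(i - 1 := t)) ` \<tau> \<alpha>)" if "i \<in> {l<..n}" for i
    using bspec[OF * that] by blast
  have "Q i \<subseteq> topspace (Euclidean_space i)" if "l \<le> i" "i \<le> n" for i
    using that
  proof (induction i rule: dec_induct)
    case base
    then show ?case using Q assms by simp
  next
    case (step i)
    obtain \<tau> where "Q (Suc i) = (\<Union>\<alpha> \<in> Q i. (\<lambda>t. \<alpha>(i := t)) ` \<tau> \<alpha>)"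
      using Q'[of "Suc i"] step by auto
    then show ?case using step by (fastforce simp: topspace_Euclidean_space)
  qed
  then show ?thesis using assms(2) Q(2) by blast
qed

text \<open>The invariant is a sample point on each level at which both polynomials are nonzero and
  whose component meets \<open>V\<close>. Delineability uses it with \<open>T\<close> a single
  point, open CADs with \<open>T\<close> a whole sample.\<close>

lemma OpenSP_meets_component:
  assumes f: "f \<noteq> 0" and j: "1 \<le> j" "j \<le> n"
    and A: "A \<in> OpenSP n (j - 1) (Hp_bar n f j) (Hp_tilde n f j) T"
    and \<alpha>: "\<alpha> \<in> T" "meval \<alpha> (Hp f (xvars n j)) \<noteq> 0" "meval \<alpha> (Hp_at f (xvars n j) (j - 1)) \<noteq> 0"
    and V: "V = connected_component_set (nonvan f) v0" "V \<inter> connected_component_set (nonvan (Hp f (xvars n j))) \<alpha> \<noteq> {}"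
  shows "A \<inter> V \<noteq> {}"
proof -
  define F where "F i = Hp f (xvars n (Suc i))" for i
  \<comment> \<open>The head of \<open>Hp_tilde\<close> is \<open>f\<close>, so on the top level
    both polynomials agree.\<close>
  define G where "G i = (if i = n then f else Hp_at f (xvars n (Suc i)) i)" for i
  obtain Q where Q: "Q (j - 1) = T" "Q n = A"
    and Q': "\<forall>i\<in>{j - 1<..n}. \<exists>\<tau>. (\<forall>\<alpha> \<in> Q (i - 1). open_sample_nz euclideanreal
           (\<lambda>t. meval (\<alpha>(i - 1 := t)) (Hp_bar n f j ! (n - i)))
           (\<lambda>t. meval (\<alpha>(i - 1 := t)) (Hp_tilde n f j ! (n - i))) (\<tau> \<alpha>)) \<and>
        Q i = (\<Union>\<alpha> \<in> Q (i - 1). (\<lambda>t. \<alpha>(i - 1 := t)) ` \<tau> \<alpha>)"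
    using A unfolding OpenSP_def mem_Collect_eq by (elim exE conjE) (rule that)
  have "\<exists>\<beta>\<in>Q i. meval \<beta> (F i) \<noteq> 0 \<and> meval \<beta> (G i) \<noteq> 0 \<and> V \<inter> connected_component_set (nonvan (F i)) \<beta> \<noteq> {}"
    if "j - 1 \<le> i" "i \<le> n" for i
    using that
  proof (induction i rule: dec_induct)
    case base
    have "F (j - 1) = Hp f (xvars n j)" "G (j - 1) = Hp_at f (xvars n j) (j - 1)"
      using j by (auto simp: F_def G_def)
    then show ?case using \<alpha> V Q by auto
  next
    case (step i)
    then have i: "i < n" by simp
    obtain \<beta> where \<beta>: "\<beta> \<in> Q i" "meval \<beta> (F i) \<noteq> 0" "meval \<beta> (G i) \<noteq> 0" "V \<inter> connected_component_set (nonvan (F i)) \<beta> \<noteq> {}"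
      using step by auto
    have "distinct (xvars n (Suc i))" "i \<in> set (xvars n (Suc i))" using i by (auto simp: xvars_Suc)
    moreover have "meval \<beta> (Hp_at f (xvars n (Suc i)) i) \<noteq> 0" using \<beta>(3) i by (simp add: G_def)
    ultimately obtain t' where t': "meval (\<beta>(i := t')) (F (Suc i)) \<noteq> 0"
        "V \<inter> connected_component_set (nonvan (F (Suc i))) (\<beta>(i := t')) \<noteq> {}"
      using component_lift[OF f _ _ \<beta>(2)[unfolded F_def] _ V(1) \<beta>(4)[unfolded F_def], of i]
      unfolding F_def remove1_xvars[OF i] by blast
    have L: "Hp_bar n f j ! (n - Suc i) = F (Suc i)"
      using Hp_bar_nth[of j "Suc i" n f] step j i by (simp add: F_def)
    have L': "Hp_tilde n f j ! (n - Suc i) = G (Suc i)"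
      using Hp_tilde_nth[of j "Suc i" n f] step j i by (cases "Suc i = n") (auto simp: G_def Hp_tilde_def)
    obtain \<tau> where \<tau>: "open_sample_nz euclideanreal (\<lambda>t. meval (\<beta>(i := t)) (F (Suc i)))
         (\<lambda>t. meval (\<beta>(i := t)) (G (Suc i))) (\<tau> \<beta>)" "Q (Suc i) = (\<Union>\<alpha> \<in> Q i. (\<lambda>t. \<alpha>(i := t)) ` \<tau> \<alpha>)"
      using bspec[OF Q', of "Suc i"] step.hyps i \<beta>(1) L L' by auto
    obtain t where t: "t \<in> \<tau> \<beta>" "meval (\<beta>(i := t)) (F (Suc i)) \<noteq> 0" "meval (\<beta>(i := t)) (G (Suc i)) \<noteq> 0"
      "connected_component {t. meval (\<beta>(i := t)) (F (Suc i)) \<noteq> 0} t' t"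
      using open_sample_real[OF \<tau>(1) t'(1)] by metis
    obtain C where C: "connected C" "C \<subseteq> {t. meval (\<beta>(i := t)) (F (Suc i)) \<noteq> 0}" "t' \<in> C" "t \<in> C"
      using t(4) by (auto simp: connected_component_def)
    have "connected_component (nonvan (F (Suc i))) (\<beta>(i := t')) (\<beta>(i := t))"
    proof (rule connected_componentI)
      show "connected ((\<lambda>t. \<beta>(i := t)) ` C)" by (intro connected_continuous_image continuous_on_upd C)
    qed (use C in \<open>auto simp: nonvan_def\<close>)
    then have "V \<inter> connected_component_set (nonvan (F (Suc i))) (\<beta>(i := t)) \<noteq> {}"
      using t'(2) connected_component_eq by fastforce
    moreover have "\<beta>(i := t) \<in> Q (Suc i)" using \<tau>(2) t(1) \<beta>(1) by blast
    ultimately show ?case using t by blast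
  qed
  from this[of n] j have "\<exists>\<beta>\<in>Q n. meval \<beta> (F n) \<noteq> 0 \<and> meval \<beta> (G n) \<noteq> 0 \<and>
      V \<inter> connected_component_set (nonvan (F n)) \<beta> \<noteq> {}" by linarith
  then obtain \<beta> where \<beta>: "\<beta> \<in> A" "V \<inter> connected_component_set (nonvan f) \<beta> \<noteq> {}" "meval \<beta> f \<noteq> 0"
    using Q by (auto simp: F_def xvars_Suc)
  then have "\<beta> \<in> connected_component_set (nonvan f) \<beta>" by (simp add: nonvan_def)
  \<comment> \<open>On the top level the component of the sample point is a component of
    \<open>f \<noteq> 0\<close> that meets \<open>V\<close>, hence it is \<open>V\<close>.\<close>
  then have "\<beta> \<in> V" using \<beta>(2) connected_component_nonoverlap[of "nonvan f" v0 \<beta>] unfolding V(1) by blast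
  then show ?thesis using \<beta>(1) by blast
qed

section \<open>Delineability over components and open CADs\<close>

lemma cylinder_self: "S \<subseteq> topspace (Euclidean_space l) \<Longrightarrow> cylinder l l S = S"
  using trunc_eq[of _ l] by (auto simp: cylinder_def trunc_def)

theorem theorem3:
  fixes n j :: nat and f :: zpoly
  assumes "2 \<le> j" and "j \<le> n" and "f \<in> Zx n"
  shows "(\<forall>U \<in> open_conn_sets (Euclidean_space (j - 1)) (\<lambda>x. meval x (Hp f (xvars n j))).
            let S = U - Zero (j - 1) {Hp_at f (xvars n j) (t - 1) | t. t \<in> {j..n}} in
            openin (Euclidean_space (j - 1)) S \<and> connectedin (Euclidean_space (j - 1)) S \<and>
            open_delineable n (j - 1) (j - 1) (Hp_bar n f j) (Hp_tilde n f j) S) \<and>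
         (\<forall>A. reduced_open_CAD n f j A \<longrightarrow> open_sample (Euclidean_space n) (\<lambda>x. meval x f) A)"
proof -
  define l where "l = j - 1"
  define Y where "Y = xvars n j"
  have l: "l < n" "1 \<le> j" using assms by (auto simp: l_def)
  have Y: "Y = rev [l..<n]" by (simp add: Y_def l_def xvars_def)
  have Y': "distinct Y" "Y \<noteq> []" "set Y = {l..<n}" using l by (auto simp: Y)
  have fn: "vars f \<subseteq> {..<n}" using assms by (simp add: Zx_iff)
  have Hp_l: "vars (Hp f Y) \<subseteq> {..<l}"
  proof (cases "f = 0")
    case False
    then have "vars (Hp f Y) \<subseteq> {..<n} - {l..<n}" using Hp_nonzero_vars[of f Y] Y' fn by blast
    then show ?thesis by auto
  qed (simp add: Hp_0)
  show ?thesis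
  proof (intro conjI ballI allI impI)
    fix U assume U: "U \<in> open_conn_sets (Euclidean_space (j - 1)) (\<lambda>x. meval x (Hp f (xvars n j)))"
    then obtain u where u: "u \<in> topspace (Euclidean_space l)" "meval u (Hp f Y) \<noteq> 0"
        "U = topspace (Euclidean_space l) \<inter> connected_component_set (nonvan (Hp f Y)) u"
      using Hp_l unfolding l_def[symmetric] Y_def[symmetric] by (rule open_conn_setsE)
    have f: "f \<noteq> 0" using u(2) by (auto simp: Hp_0)
    note props = Hp_nonzero_vars[OF f Y'(1)]
    define UX where "UX = connected_component_set (nonvan (Hp f Y)) u"
    define Z where "Z = {x. \<forall>z\<in>set Y. meval x (Hp_at f Y z) = 0}"
    define S where "S = U - Zero l {Hp_at f Y (t - 1) | t. t \<in> {j..n}}"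
    have UX: "open UX" "connected UX" "UX \<subseteq> nonvan (Hp f Y)"
      unfolding UX_def by (simp_all add: open_component open_nonvan connected_component_subset)
    have "{t - 1 | t. t \<in> {j..n}} = set Y"
    proof (intro subset_antisym subsetI)
      fix z assume "z \<in> set Y"
      then show "z \<in> {t - 1 | t. t \<in> {j..n}}" using l by (intro CollectI exI[of _ "Suc z"]) (auto simp: Y' l_def)
    qed (use l in \<open>auto simp: Y' l_def\<close>)
    then have "{Hp_at f Y (t - 1) | t. t \<in> {j..n}} = Hp_at f Y ` set Y" by (simp add: setcompr_eq_image image_image flip: \<open>_ = set Y\<close>)
    then have S: "S = topspace (Euclidean_space l) \<inter> (UX - Z)"
      unfolding S_def u(3) Zero_def Z_def UX_def by auto
    have conn: "connected (UX - Z)"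
      unfolding Z_def by (rule connected_Diff_zeros_Hp_at[OF f Y'(1,2) UX])
    have "Z = (\<Inter>z\<in>set Y. {x. meval x (Hp_at f Y z) = 0})" by (auto simp: Z_def)
    then have "closed Z" by (auto intro!: closed_INT closed_Collect_eq continuous_intros)
    have inUX: "trunc l x \<in> UX" if "x \<in> UX" for x
      using that UX(3) component_trunc[OF Hp_l, of x] connected_component_trans
      unfolding UX_def nonvan_def by blast
    have at_l: "vars (Hp_at f Y z) \<subseteq> {..<l}" if "z \<in> set Y" for z
      using props that fn by (fastforce simp: Y')
    have inUXZ: "trunc l x \<in> UX - Z" if "x \<in> UX - Z" for x
      using that inUX meval_trunc[OF at_l] by (auto simp: Z_def)
    \<comment> \<open>Connectedness of \<open>S\<close> in R^l is inherited from
      \<open>UX - Z\<close> through truncation.\<close>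
    have S_image: "S = trunc l ` (UX - Z)"
    proof (intro subset_antisym subsetI)
      fix x assume "x \<in> S"
      then show "x \<in> trunc l ` (UX - Z)" using trunc_eq[of x l] unfolding S by (metis IntD1 IntD2 image_eqI)
    next
      fix x assume "x \<in> trunc l ` (UX - Z)"
      then show "x \<in> S" using inUXZ trunc_in_Euclidean_space unfolding S by blast
    qed
    have "openin (Euclidean_space l) S"
      unfolding S by (subst Euclidean_space_top_of_set) (intro openin_open_Int open_Diff UX \<open>closed Z\<close>)
    moreover have "connectedin (Euclidean_space l) S"
    proof -
      have "connected S" unfolding S_image by (intro connected_continuous_image continuous_on_trunc conn)
      then show ?thesis
        using S by (subst Euclidean_space_top_of_set) (auto simp: connectedin_subtopology)
    qed
    moreover have "open_delineable n l l (Hp_bar n f j) (Hp_tilde n f j) S"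
      unfolding open_delineable_def Hp_lists_hd_last[OF l(2) assms(2)]
    proof (intro ballI impI)
      fix V \<alpha> A
      assume V: "V \<in> open_conn_sets (Euclidean_space n) (\<lambda>x. meval x f)"
        and VS: "V \<inter> cylinder l n (cylinder l l S) \<noteq> {}" and \<alpha>: "\<alpha> \<in> cylinder l l S"
        and nz: "meval \<alpha> (Hp f (xvars n j)) * meval \<alpha> (Hp_at f (xvars n j) (j - 1)) \<noteq> 0"
        and A: "A \<in> OpenSP n l (Hp_bar n f j) (Hp_tilde n f j) {\<alpha>}"
      have cyl: "cylinder l l S = S" using S by (intro cylinder_self) auto
      obtain v0 where v0: "V = topspace (Euclidean_space n) \<inter> connected_component_set (nonvan f) v0"
        using open_conn_setsE[OF V fn] by metis
      obtain v where v: "v \<in> V" "trunc l v \<in> S" using VS unfolding cyl by (auto simp: cylinder_def trunc_def)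
      then have "trunc l v \<in> UX" by (simp add: S)
      then have "meval v (Hp f Y) \<noteq> 0" using UX(3) meval_trunc[OF Hp_l, of v] by (auto simp: nonvan_def)
      then have "connected_component (nonvan (Hp f Y)) (trunc l v) v"
        using component_trunc[OF Hp_l] connected_component_sym by blast
      then have "v \<in> UX" using \<open>trunc l v \<in> UX\<close> connected_component_trans unfolding UX_def by blast
      moreover have \<alpha>: "\<alpha> \<in> topspace (Euclidean_space l)" "\<alpha> \<in> UX" using \<alpha> cyl unfolding S by simp_all
      have "connected_component_set (nonvan (Hp f Y)) \<alpha> = UX"
        using \<alpha>(2) connected_component_eq unfolding UX_def by blast
      ultimately have "connected_component_set (nonvan f) v0 \<inter> connected_component_set (nonvan (Hp f Y)) \<alpha> \<noteq> {}"
        using v(1) v0 by blast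
      then have "A \<inter> connected_component_set (nonvan f) v0 \<noteq> {}"
        using OpenSP_meets_component[OF f l(2) assms(2) A[unfolded l_def] _ _ _ refl] nz by (simp add: Y_def)
      moreover have "A \<subseteq> topspace (Euclidean_space n)" using OpenSP_subset[OF A] l \<alpha> by simp
      ultimately show "A \<inter> V \<noteq> {}" using v0 by blast
    qed
    ultimately show "let S = U - Zero (j - 1) {Hp_at f (xvars n j) (t - 1) | t. t \<in> {j..n}} in
            openin (Euclidean_space (j - 1)) S \<and> connectedin (Euclidean_space (j - 1)) S \<and>
            open_delineable n (j - 1) (j - 1) (Hp_bar n f j) (Hp_tilde n f j) S"
      by (simp add: Let_def S_def Y_def l_def)
  next
    fix A assume "reduced_open_CAD n f j A"
    then obtain T where T: "open_sample_nz (Euclidean_space l) (\<lambda>x. meval x (Hp f Y)) (\<lambda>x. meval x (Hp_at f Y l)) T"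
      and A: "A \<in> OpenSP n (j - 1) (Hp_bar n f j) (Hp_tilde n f j) T"
      by (auto simp: reduced_open_CAD_def l_def Y_def)
    have "T \<subseteq> topspace (Euclidean_space l)" using T by (simp add: open_sample_nz_def open_sample_def)
    then have An: "A \<subseteq> topspace (Euclidean_space n)" using OpenSP_subset[OF A] l by (simp add: l_def)
    moreover have "A \<inter> V \<noteq> {}" if V: "V \<in> open_conn_sets (Euclidean_space n) (\<lambda>x. meval x f)" for V
    proof -
      obtain v0 where v0: "meval v0 f \<noteq> 0" "V = topspace (Euclidean_space n) \<inter> connected_component_set (nonvan f) v0"
        using open_conn_setsE[OF V fn] by metis
      have f: "f \<noteq> 0" using v0(1) by auto
      let ?V = "connected_component_set (nonvan f) v0"
      have "v0 \<in> ?V" using v0(1) by (simp add: nonvan_def)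
      \<comment> \<open>The component is open, so it has a point off the zeros of
        \<open>Hp f Y\<close>; its first \<open>l\<close> coordinates determine the component that
        the sample \<open>T\<close> has to meet.\<close>
      then obtain v where v: "v \<in> ?V" "meval v (Hp f Y) \<noteq> 0"
        using nonvanishing_dense[OF _ open_component[OF open_nonvan]] Hp_nonzero_vars[OF f Y'(1)] by blast
      have "meval (trunc l v) (Hp f Y) \<noteq> 0" using v(2) meval_trunc[OF Hp_l, of v] by simp
      then have "topspace (Euclidean_space l) \<inter> connected_component_set (nonvan (Hp f Y)) (trunc l v)
          \<in> open_conn_sets (Euclidean_space l) (\<lambda>x. meval x (Hp f Y))"
        by (intro open_conn_setsI Hp_l) auto
      then obtain \<alpha> where \<alpha>: "\<alpha> \<in> T" "connected_component (nonvan (Hp f Y)) (trunc l v) \<alpha>"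
        using T unfolding open_sample_nz_def open_sample_def by fast
      have "meval \<alpha> (Hp f Y) \<noteq> 0" using connected_component_in[OF \<alpha>(2)] by (simp add: nonvan_def)
      moreover have "meval \<alpha> (Hp_at f Y l) \<noteq> 0" using T \<alpha>(1) by (simp add: open_sample_nz_def)
      moreover have "connected_component (nonvan (Hp f Y)) \<alpha> v"
        using \<alpha>(2) component_trunc[OF Hp_l v(2)] connected_component_sym connected_component_trans by metis
      then have "?V \<inter> connected_component_set (nonvan (Hp f Y)) \<alpha> \<noteq> {}" using v(1) by blast
      ultimately have "A \<inter> ?V \<noteq> {}"
        using OpenSP_meets_component[OF f l(2) assms(2) A \<alpha>(1) _ _ refl] by (simp add: Y_def l_def)
      then show ?thesis using v0(2) An by blast
    qed
    ultimately show "open_sample (Euclidean_space n) (\<lambda>x. meval x f) A" by (simp add: open_sample_def)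
  qed
qed

end
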